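(* Let $n, m$ be integers greater than $1$, let $V$ be a free $(\mathbb{Z}/n\mathbb{Z})$-module of rank $m$, and let $\Gamma$ be a subgroup of $\operatorname{Aut}(V) \cong GL_m(\mathbb{Z}/n\mathbb{Z})$. Let $W$ be a $\Gamma$-invariant $\mathbb{Z}/n\mathbb{Z}$-submodule of $V$ such that the action of $\Gamma$ on $W$ is abelian, i.e. the image $\Gamma|_W$ of $\Gamma$ in $\operatorname{Aut}(W)$ is an abelian group. Let $I(\Gamma) := (\operatorname{Aut}(V):\Gamma)$ be the index of $\Gamma$ in $\operatorname{Aut}(V)$. Then $$|W| \leq I(\Gamma)^{1+\frac{m}{2}}\,\zeta(2)^{(m-1)\left(1+\frac{m}{2}\right)}.$$
   Context: $|W|$ denotes the cardinality of the finite set $W$. $\operatorname{Aut}(V)$ is the group of $\mathbb{Z}/n\mathbb{Z}$-linear automorphisms of $V$. $\zeta$ is the Riemann zeta function, so $\zeta(2)=\sum_{k\ge 1}k^{-2}=\pi^2/6$. *)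

theory Defs
  imports "HOL-Analysis.Analysis" "HOL-Algebra.Algebra" "HOL-Number_Theory.Residues"
begin

definition module_basis ::
    "('r, 'a) ring_scheme \<Rightarrow> ('r, 'v, 'b) module_scheme \<Rightarrow> 'v set \<Rightarrow> bool" where
  "module_basis R M B \<longleftrightarrow> finite B \<and> B \<subseteq> carrier M \<and>
     (\<forall>v \<in> carrier M. \<exists>!c. c \<in> B \<rightarrow>\<^sub>E carrier R \<and> v = (\<Oplus>\<^bsub>M\<^esub>b\<in>B. c b \<odot>\<^bsub>M\<^esub> b))"

definition free_module_of_rank ::
    "('r, 'a) ring_scheme \<Rightarrow> ('r, 'v, 'b) module_scheme \<Rightarrow> nat \<Rightarrow> bool" where
  "free_module_of_rank R M m \<longleftrightarrow>
     module R M \<and> (\<exists>B. module_basis R M B \<and> card B = m)"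

text \<open>
  As in \<^theory>\<open>HOL-Algebra.Bij\<close>, automorphisms are taken to be extensional (undefined outside
  the carrier), so that each automorphism is represented by exactly one HOL function.
\<close>

definition linear_automorphisms ::
    "('r, 'a) ring_scheme \<Rightarrow> ('r, 'v, 'b) module_scheme \<Rightarrow> ('v \<Rightarrow> 'v) set" where
  "linear_automorphisms R M = {f \<in> Bij (carrier M).
     (\<forall>x \<in> carrier M. \<forall>y \<in> carrier M. f (x \<oplus>\<^bsub>M\<^esub> y) = f x \<oplus>\<^bsub>M\<^esub> f y) \<and>
     (\<forall>a \<in> carrier R. \<forall>x \<in> carrier M. f (a \<odot>\<^bsub>M\<^esub> x) = a \<odot>\<^bsub>M\<^esub> f x)}"

definition module_Aut ::
    "('r, 'a) ring_scheme \<Rightarrow> ('r, 'v, 'b) module_scheme \<Rightarrow> ('v \<Rightarrow> 'v) monoid" where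
  "module_Aut R M = BijGroup (carrier M) \<lparr>carrier := linear_automorphisms R M\<rparr>"

lemma (in module) group_module_Aut: "group (module_Aut R M)"
proof -
  have "subgroup (linear_automorphisms R M) (BijGroup (carrier M))"
  proof (rule subgroup.intro)
    show "linear_automorphisms R M \<subseteq> carrier (BijGroup (carrier M))"
      by (auto simp: linear_automorphisms_def BijGroup_def)
  next
    fix f g assume "f \<in> linear_automorphisms R M" "g \<in> linear_automorphisms R M"
    then show "f \<otimes>\<^bsub>BijGroup (carrier M)\<^esub> g \<in> linear_automorphisms R M"
      using Bij_imp_funcset[of f "carrier M"] Bij_imp_funcset[of g "carrier M"]
      by (auto simp: linear_automorphisms_def BijGroup_def compose_Bij compose_def Pi_def
          intro: compose_Bij[unfolded compose_def])
  next
    show "\<one>\<^bsub>BijGroup (carrier M)\<^esub> \<in> linear_automorphisms R M"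
      by (simp add: linear_automorphisms_def BijGroup_def id_Bij)
  next
    fix f assume f: "f \<in> linear_automorphisms R M"
    let ?g = "inv_into (carrier M) f"
    have bij: "f \<in> Bij (carrier M)"
      and add: "\<And>x y. x \<in> carrier M \<Longrightarrow> y \<in> carrier M \<Longrightarrow> f (x \<oplus>\<^bsub>M\<^esub> y) = f x \<oplus>\<^bsub>M\<^esub> f y"
      and scl: "\<And>a x. a \<in> carrier R \<Longrightarrow> x \<in> carrier M \<Longrightarrow> f (a \<odot>\<^bsub>M\<^esub> x) = a \<odot>\<^bsub>M\<^esub> f x"
      using f by (auto simp: linear_automorphisms_def)
    have inj: "inj_on f (carrier M)" and im: "f ` carrier M = carrier M"
      using bij by (auto simp: Bij_def bij_betw_def)
    have fg: "f (?g x) = x" "?g x \<in> carrier M" if "x \<in> carrier M" for x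
      using that im by (auto simp: f_inv_into_f Bij_inv_into_mem[OF bij])
    have "?g (x \<oplus>\<^bsub>M\<^esub> y) = ?g x \<oplus>\<^bsub>M\<^esub> ?g y" if "x \<in> carrier M" "y \<in> carrier M" for x y
      using that fg add inj by (intro inv_into_f_eq) auto
    moreover have "?g (a \<odot>\<^bsub>M\<^esub> x) = a \<odot>\<^bsub>M\<^esub> ?g x" if "a \<in> carrier R" "x \<in> carrier M" for a x
      using that fg scl inj by (intro inv_into_f_eq) auto
    ultimately show "inv\<^bsub>BijGroup (carrier M)\<^esub> f \<in> linear_automorphisms R M"
      using restrict_inv_into_Bij[OF bij]
      by (simp add: linear_automorphisms_def inv_BijGroup[OF bij])
  qed
  then show ?thesis
    unfolding module_Aut_def
    by (rule subgroup.subgroup_is_group[OF _ group_BijGroup])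
qed

definition subgroup_index :: "('g, 'a) monoid_scheme \<Rightarrow> 'g set \<Rightarrow> nat" where
  "subgroup_index G H = card (rcosets\<^bsub>G\<^esub> H)"

definition invariant_under :: "('v \<Rightarrow> 'v) set \<Rightarrow> 'v set \<Rightarrow> bool" where
  "invariant_under \<Gamma> W \<longleftrightarrow> (\<forall>g \<in> \<Gamma>. g ` W \<subseteq> W)"

text \<open>The image of \<open>\<Gamma>\<close> in \<open>Aut(W)\<close>, as a group under the composition of \<open>Aut(W)\<close>.\<close>

definition restricted_group ::
    "('r, 'a) ring_scheme \<Rightarrow> ('r, 'v, 'b) module_scheme \<Rightarrow> ('v \<Rightarrow> 'v) set \<Rightarrow> 'v set
      \<Rightarrow> ('v \<Rightarrow> 'v) monoid" where
  "restricted_group R M \<Gamma> W =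
     module_Aut R (M\<lparr>carrier := W\<rparr>) \<lparr>carrier := (\<lambda>g. restrict g W) ` \<Gamma>\<rparr>"

text \<open>The Riemann zeta function at real arguments \<open>s > 1\<close>, by its Dirichlet series.\<close>

definition zeta :: "real \<Rightarrow> real" where
  "zeta s = suminf (\<lambda>k. 1 / real (Suc k) powr s)"

end

theory Submission
  imports Defs
begin

text \<open>
  Let \<open>d\<close> be the exponent of \<open>W\<close> and \<open>w \<in> W\<close> a vector of order \<open>d\<close>, so that \<open>|W| \<le> d\<^sup>m\<close>; it suffices
  to show \<open>d\<^sup>m\<^sup>-\<^sup>1 \<le> \<zeta>(2) I(\<Gamma>)\<close>, because \<open>m / (m - 1) \<le> 1 + m / 2\<close>. The vectors \<open>v \<in> W\<close>
  such that \<open>g v\<close> depends only on \<open>g w\<close>, for \<open>g \<in> \<Gamma>\<close>, form a subgroup \<open>U\<close> of \<open>W\<close>, and \<open>\<Gamma>w \<subseteq> U\<close> because \<open>\<Gamma>\<close> is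
  abelian on \<open>W\<close>. So \<open>\<Gamma>\<close> induces only \<open>|\<Gamma>w| \<le> |U|\<close> maps \<open>U \<rightarrow> V\<close>. The full group \<open>Aut(V)\<close> induces many more: the image of \<open>w\<close> is an arbitrary vector of order \<open>d\<close>,
  and once it is fixed, the transvections \<open>v \<mapsto> v + f(v) v\<^sub>1\<close>, where \<open>w\<close> is a multiple of \<open>v\<^sub>1\<close>
  and \<open>f(v\<^sub>1) = 0\<close>, still give \<open>|U| / d\<close> different maps by duality. Hence \<open>I(\<Gamma>)\<close> is at least the number
  \<open>d\<^sup>m \<Prod>\<^sub>p (1 - p\<^sup>-\<^sup>m)\<close> of vectors of order \<open>d\<close>, divided by \<open>d\<close>.
\<close>

hide_const (open) Divisibility.prime

section \<open>Finite Euler products for \<open>zeta 2\<close>\<close>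

text \<open>Moves the shifted series over \<open>nat\<close> to an unordered sum over the positive
  integers, from which terms can be removed according to divisibility.\<close>

lemma has_sum_zeta_2: "((\<lambda>k::int. 1 / (real_of_int k)^2) has_sum zeta 2) {0<..}"
proof -
  have eq: "(\<lambda>k. 1 / real (Suc k) powr 2) = (\<lambda>k. 1 / (real_of_int (int (Suc k)))^2)"
    by (rule ext) (simp add: powr_realpow[of "real (Suc _)" 2, simplified])
  have "summable (\<lambda>k. 1 / real (Suc k) powr 2)"
    unfolding eq of_int_of_nat_eq
    using inverse_power_summable[of 2, where ?'a = real]
    by (subst summable_Suc_iff[of "\<lambda>k. 1 / (real k)^2"]) (simp add: inverse_eq_divide)
  then have "(\<lambda>k. 1 / real (Suc k) powr 2) sums zeta 2"
    unfolding zeta_def by (rule summable_sums)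
  then have "((\<lambda>k. 1 / (real_of_int (int (Suc k)))^2) has_sum zeta 2) UNIV"
    unfolding eq by (intro sums_nonneg_imp_has_sum) auto
  moreover have "bij_betw (\<lambda>k. int (Suc k)) UNIV {0<..}"
    by (rule bij_betwI[where g = "\<lambda>k. nat (k - 1)"]) auto
  ultimately show ?thesis
    using has_sum_reindex_bij_betw[where g = "\<lambda>k. int (Suc k)" and f = "\<lambda>k. 1 / (real_of_int k)^2"]
    by blast
qed

text \<open>
  Removing from the series the multiples of a further prime \<open>q\<close> multiplies the sum by
  \<open>1 - 1 / q\<^sup>2\<close>; the term \<open>k = 1\<close> survives every step.
\<close>

lemma euler_product_has_sum:
  fixes P :: "int set"
  assumes "finite P" "\<And>p. p \<in> P \<Longrightarrow> prime p"
  shows "((\<lambda>k::int. 1 / (real_of_int k)^2) has_sum (zeta 2 * (\<Prod>p\<in>P. 1 - 1 / (real_of_int p)^2)))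
    {k. k > 0 \<and> (\<forall>p\<in>P. \<not> p dvd k)}"
  using assms
proof (induction P)
  case empty
  then show ?case using has_sum_zeta_2 by (simp add: greaterThan_def)
next
  case (insert q P)
  let ?S = "\<lambda>P::int set. {k::int. k > 0 \<and> (\<forall>p\<in>P. \<not> p dvd k)}"
  let ?f = "\<lambda>k::int. 1 / (real_of_int k)^2"
  define z where "z = zeta 2 * (\<Prod>p\<in>P. 1 - 1 / (real_of_int p)^2)"
  have q: "prime q" "q > 0" using insert.prems prime_gt_0_int by auto
  have IH: "(?f has_sum z) (?S P)" unfolding z_def using insert by simp
  have "((\<lambda>k. 1 / (real_of_int q)^2 * ?f k) has_sum (1 / (real_of_int q)^2 * z)) (?S P)"
    by (intro has_sum_cmult_right IH)
  then have "((?f \<circ> (*) q) has_sum (1 / (real_of_int q)^2 * z)) (?S P)"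
    by (simp add: o_def power_mult_distrib)
  then have mult: "(?f has_sum (1 / (real_of_int q)^2 * z)) ((*) q ` ?S P)"
    using q by (subst has_sum_reindex) (auto intro!: inj_onI)
  have ndvd: "\<not> p dvd q" if "p \<in> P" for p
    using that insert q primes_dvd_imp_eq[of p q] by auto
  have sub: "(*) q ` ?S P \<subseteq> ?S P"
    using q ndvd insert.prems by (auto simp: prime_dvd_mult_iff)
  have "(?f has_sum (z - 1 / (real_of_int q)^2 * z)) (?S P - (*) q ` ?S P)"
    by (rule has_sum_Diff[OF IH mult sub])
  moreover have "?S P - (*) q ` ?S P = ?S (insert q P)"
  proof -
    have div: "k \<in> (*) q ` ?S P" if k: "k \<in> ?S P" and dvd: "q dvd k" for k
    proof -
      from dvd obtain l where l: "k = q * l" by (rule dvdE)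
      have "l > 0" using k q unfolding l by (simp add: zero_less_mult_iff)
      moreover have "\<not> p dvd l" if "p \<in> P" for p
        using k that unfolding l by auto
      ultimately show ?thesis unfolding l by blast
    qed
    show ?thesis
    proof (intro Set.set_eqI iffI)
      fix k assume k: "k \<in> ?S P - (*) q ` ?S P"
      then have "\<not> q dvd k" using div by blast
      then show "k \<in> ?S (insert q P)" using k by simp
    next
      fix k assume k: "k \<in> ?S (insert q P)"
      then have "k \<notin> (*) q ` ?S P" by auto
      then show "k \<in> ?S P - (*) q ` ?S P" using k by simp
    qed
  qed
  moreover have "z - 1 / (real_of_int q)^2 * z
      = zeta 2 * (\<Prod>p\<in>insert q P. 1 - 1 / (real_of_int p)^2)"
    using insert.hyps by (simp add: z_def algebra_simps)
  ultimately show ?case by simp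
qed

text \<open>The sieved series has nonnegative terms, and \<open>k = 1\<close> alone contributes 1
  because no prime divides 1.\<close>

lemma zeta_2_mult_euler_product_ge_1:
  fixes P :: "int set"
  assumes "finite P" "\<And>p. p \<in> P \<Longrightarrow> prime p"
  shows "1 \<le> zeta 2 * (\<Prod>p\<in>P. 1 - 1 / (real_of_int p)^2)"
proof -
  let ?f = "\<lambda>k::int. 1 / (real_of_int k)^2"
  have "(?f has_sum 1) {1}" using has_sum_finite[of "{1}" ?f] by simp
  moreover note euler_product_has_sum[OF assms]
  ultimately show ?thesis
  proof (rule has_sum_mono2)
    show "{1} \<subseteq> {k. 0 < k \<and> (\<forall>p\<in>P. \<not> p dvd k)}"
      using assms(2) not_prime_unit by (auto simp del: zdvd1_eq)
  qed auto
qed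

section \<open>Counting tuples that are primitive at given primes\<close>

text \<open>Sieving one prime at a time. A tuple whose entries are all divisible by \<open>q\<close>
  is \<open>q\<close> times a tuple bounded by \<open>d div q\<close>, and this scaling preserves
  primitivity at the other primes, so adding \<open>q\<close> to \<open>P\<close> multiplies the
  count by \<open>1 - 1 / q ^ card B\<close>. The induction generalizes \<open>d\<close> because it
  is used for both \<open>d\<close> and \<open>d div q\<close>.\<close>

lemma card_primitive_tuples:
  fixes P :: "int set" and d :: int
  assumes "finite P" "\<And>p. p \<in> P \<Longrightarrow> prime p" "finite B" "d > 0" "\<And>p. p \<in> P \<Longrightarrow> p dvd d"
  shows "real (card {c \<in> B \<rightarrow>\<^sub>E {0..<d}. \<forall>p\<in>P. \<exists>b\<in>B. \<not> p dvd c b})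
    = (real_of_int d) ^ card B * (\<Prod>p\<in>P. 1 - 1 / (real_of_int p) ^ card B)"
  using assms
proof (induction P arbitrary: d)
  case empty
  then show ?case by (simp add: card_PiE)
next
  case (insert q P)
  let ?A = "\<lambda>P d. {c \<in> B \<rightarrow>\<^sub>E {0..<d}. \<forall>p\<in>P. \<exists>b\<in>B. \<not> p dvd c b}"
  let ?\<Pi> = "\<Prod>p\<in>P. 1 - 1 / (real_of_int p) ^ card B"
  have q: "prime q" "q > 0" using insert.prems prime_gt_0_int by auto
  obtain d' where d': "d = q * d'" using insert.prems(4) by blast
  then have "d' > 0" using q insert.prems by (simp add: zero_less_mult_iff)
  have ndvd: "\<not> p dvd q" if "p \<in> P" for p
    using that insert q primes_dvd_imp_eq[of p q] by auto
  have fin: "finite (?A P d)" for P and d :: int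
    by (rule finite_subset[of _ "B \<rightarrow>\<^sub>E {0..<d}"]) (use insert.prems in \<open>auto intro!: finite_PiE\<close>)
  have IH: "real (card (?A P d)) = (real_of_int d) ^ card B * ?\<Pi>"
    using insert by simp
  have IH': "real (card (?A P d')) = (real_of_int d') ^ card B * ?\<Pi>"
  proof (rule insert.IH)
    show "p dvd d'" if "p \<in> P" for p
      using that insert.prems(1,4) ndvd[OF that] d' by (metis insertCI prime_dvd_mult_iff)
  qed (use insert.prems \<open>d' > 0\<close> in auto)
  let ?h = "\<lambda>c. \<lambda>b\<in>B. q * c b"
  have "bij_betw ?h (?A P d') (?A P d - ?A (insert q P) d)"
  proof (rule bij_betwI[where g = "\<lambda>c. \<lambda>b\<in>B. c b div q"])
    show "?h \<in> ?A P d' \<rightarrow> ?A P d - ?A (insert q P) d"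
      using q ndvd d' insert.prems(1) by (auto simp: prime_dvd_mult_iff PiE_iff)
  next
    have "c b div q \<in> {0..<d'} \<and> c b = q * (c b div q)"
      if "c \<in> ?A P d - ?A (insert q P) d" "b \<in> B" for c b
    proof -
      have "q dvd c b" using that by auto
      then obtain l where "c b = q * l" by blast
      moreover have "0 \<le> c b" "c b < d" using that by (auto simp: PiE_iff)
      ultimately show ?thesis using q d' by (auto simp: zero_le_mult_iff)
    qed
    note div = this
    show "(\<lambda>c. \<lambda>b\<in>B. c b div q) \<in> ?A P d - ?A (insert q P) d \<rightarrow> ?A P d'"
    proof (intro funcsetI CollectI conjI ballI)
      fix c assume c: "c \<in> ?A P d - ?A (insert q P) d"
      show "(\<lambda>b\<in>B. c b div q) \<in> B \<rightarrow>\<^sub>E {0..<d'}" using div[OF c] by auto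
      fix p assume "p \<in> P"
      then obtain b where "b \<in> B" "\<not> p dvd c b" using c by auto
      then show "\<exists>b\<in>B. \<not> p dvd (\<lambda>b\<in>B. c b div q) b" using div[OF c, of b]
        by (intro bexI[of _ b]) auto
    qed
    show "(\<lambda>b\<in>B. (?h c) b div q) = c" if "c \<in> ?A P d'" for c
      using that q by (auto simp: fun_eq_iff PiE_iff extensional_def)
    show "?h (\<lambda>b\<in>B. c b div q) = c" if "c \<in> ?A P d - ?A (insert q P) d" for c
    proof
      fix b show "?h (\<lambda>b\<in>B. c b div q) b = c b"
        using div[OF that, of b] that by (auto simp: PiE_iff extensional_def)
    qed
  qed
  then have "card (?A P d') = card (?A P d - ?A (insert q P) d)" by (rule bij_betw_same_card)
  also have "\<dots> = card (?A P d) - card (?A (insert q P) d)"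
    by (rule card_Diff_subset[OF fin]) auto
  finally have "card (?A P d') = card (?A P d) - card (?A (insert q P) d)" .
  moreover have "card (?A (insert q P) d) \<le> card (?A P d)" by (rule card_mono[OF fin]) auto
  ultimately have "real (card (?A (insert q P) d)) = real (card (?A P d)) - real (card (?A P d'))"
    by linarith
  also have "\<dots> = (real_of_int d) ^ card B * ?\<Pi> * (1 - 1 / (real_of_int q) ^ card B)"
    unfolding IH IH' using q by (simp add: d' field_simps power_mult_distrib)
  finally show ?case using insert.hyps by (simp add: ac_simps)
qed

section \<open>Duality modulo \<open>n\<close> by character sums\<close>

text \<open>Orthogonality for the characters of the integers modulo \<open>n\<close>: unless
  \<open>n dvd a\<close>, the sum is geometric and its ratio is an \<open>n\<close>-th root of unity
  other than 1.\<close>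

lemma sum_roots_of_unity_int:
  fixes n a :: int
  assumes "n > 0"
  shows "(\<Sum>k\<in>{0..<n}. cis (2 * pi * real_of_int (k * a) / real_of_int n))
    = (if n dvd a then of_int n else 0)"
proof (cases "n dvd a")
  case True
  then obtain l where "a = n * l" by blast
  then have "cis (2 * pi * real_of_int (k * a) / real_of_int n) = 1" for k
    using assms cis_multiple_2pi[of "real_of_int (k * l)"] by (simp add: field_simps)
  with True assms show ?thesis by simp
next
  case False
  let ?z = "cis (2 * pi * real_of_int a / real_of_int n)"
  have "?z \<noteq> 1"
  proof
    assume "?z = 1"
    then have "cos (2 * pi * real_of_int a / real_of_int n) = 1" by (simp add: complex_eq_iff)
    then obtain l :: int where "2 * pi * real_of_int a / real_of_int n = of_int l * 2 * pi"
      unfolding cos_one_2pi_int by blast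
    then have "real_of_int a = of_int (l * n)" using assms by (simp add: field_simps)
    then have "a = l * n" by linarith
    with False show False by simp
  qed
  have pw: "?z ^ nat n = 1"
    using assms cis_multiple_2pi[of "real_of_int a"] by (simp add: Complex.DeMoivre field_simps)
  have "(\<Sum>k\<in>{0..<n}. cis (2 * pi * real_of_int (k * a) / real_of_int n)) = (\<Sum>k<nat n. ?z ^ k)"
    by (rule sum.reindex_bij_witness[of _ int nat])
      (auto simp: Complex.DeMoivre field_simps)
  also have "\<dots> = 0"
    using geometric_sum[OF \<open>?z \<noteq> 1\<close>, of "nat n"] pw by simp
  finally show ?thesis using False by simp
qed

text \<open>Both sides are the sum of \<open>\<psi> (pair f u)\<close> over all \<open>f\<close> and
  \<open>u\<close>. For fixed \<open>f\<close> the sum over \<open>U\<close> is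
  \<open>card U\<close> if \<open>f\<close> annihilates \<open>U\<close> and 0 otherwise; for fixed
  \<open>u\<close> the sum over \<open>f\<close> factors into root-of-unity sums, which vanish
  unless \<open>n\<close> divides all coordinates of \<open>u\<close>. The group structure of
  \<open>U\<close> enters through an operation \<open>s\<close> with bijective translations and
  coordinates \<open>x\<close> additive modulo \<open>n\<close>.\<close>

lemma card_functional_annihilator:
  fixes n :: int and x :: "'a \<Rightarrow> 'b \<Rightarrow> int"
  assumes n: "n > 0" and fin: "finite D" "finite U"
    and bij: "\<And>a. a \<in> U \<Longrightarrow> bij_betw (s a) U U"
    and add: "\<And>a b j. a \<in> U \<Longrightarrow> b \<in> U \<Longrightarrow> j \<in> D \<Longrightarrow> [x (s a b) j = x a j + x b j] (mod n)"
  shows "card {f \<in> D \<rightarrow>\<^sub>E {0..<n}. \<forall>u\<in>U. n dvd (\<Sum>j\<in>D. f j * x u j)} * card U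
    = nat n ^ card D * card {u \<in> U. \<forall>j\<in>D. n dvd x u j}"
proof -
  define \<psi> where "\<psi> a = cis (2 * pi * real_of_int a / real_of_int n)" for a
  define pair where "pair f u = (\<Sum>j\<in>D. f j * x u j)" for f u
  let ?F = "D \<rightarrow>\<^sub>E {0..<n}"
  let ?K = "{f \<in> ?F. \<forall>u\<in>U. n dvd pair f u}"
  let ?Z = "{u \<in> U. \<forall>j\<in>D. n dvd x u j}"
  have \<psi>_add: "\<psi> (a + b) = \<psi> a * \<psi> b" for a b
    by (simp add: \<psi>_def cis_mult add_divide_distrib distrib_left)
  have \<psi>_1: "\<psi> a = 1" if "n dvd a" for a
  proof -
    from that obtain l where "a = n * l" by (rule dvdE)
    then have "2 * pi * real_of_int a / real_of_int n = 2 * pi * real_of_int l" using n by simp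
    then show ?thesis using cis_multiple_2pi[of "real_of_int l"] by (simp only: \<psi>_def Ints_of_int)
  qed
  have \<psi>_iff: "\<psi> a = 1 \<longleftrightarrow> n dvd a" for a
  proof
    assume a: "\<psi> a = 1"
    \<comment> \<open>The nonnegative multiples of \<open>a\<close> then also have
      \<open>\<psi>\<close> equal to 1, so the root-of-unity sum for \<open>a\<close> is
      \<open>n\<close> and not 0.\<close>
    have pw: "\<psi> (k * a) = 1" if "k \<ge> 0" for k
      using that by (induction k rule: int_ge_induct) (auto simp: distrib_right \<psi>_add a \<psi>_1)
    have "(\<Sum>k\<in>{0..<n}. \<psi> (k * a)) = of_int n" using n pw by simp
    then show "n dvd a" using n sum_roots_of_unity_int[OF n, of a] by (auto simp: \<psi>_def split: if_splits)
  qed (rule \<psi>_1)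
  have \<psi>_sum: "\<psi> (\<Sum>j\<in>A. g j) = (\<Prod>j\<in>A. \<psi> (g j))" if "finite A" for A :: "'b set" and g
    using that by (induction A) (auto simp: \<psi>_add \<psi>_1)
  have \<psi>_cong: "\<psi> a = \<psi> b" if "[a = b] (mod n)" for a b
    using that \<psi>_add[of "a - b" b] \<psi>_1[of "a - b"] by (simp add: cong_iff_dvd_diff)
  have finF: "finite ?F" using fin by (intro finite_PiE) auto
  have over_U: "(\<Sum>u\<in>U. \<psi> (pair f u)) = (if f \<in> ?K then of_nat (card U) else 0)" if f: "f \<in> ?F" for f
  proof (cases "f \<in> ?K")
    case True
    then show ?thesis by (simp add: \<psi>_1)
  next
    case False
    then obtain a where a: "a \<in> U" "\<not> n dvd pair f a" using f by blast
    \<comment> \<open>Translation by \<open>a\<close> permutes \<open>U\<close> and multiplies the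
      sum by \<open>\<psi> (pair f a)\<close>, which differs from 1, so the sum is 0.\<close>
    have "\<psi> (pair f (s a u)) = \<psi> (pair f a) * \<psi> (pair f u)" if "u \<in> U" for u
    proof -
      have "[pair f (s a u) = (\<Sum>j\<in>D. f j * (x a j + x u j))] (mod n)"
        unfolding pair_def using a that by (intro cong_sum cong_mult add) auto
      also have "(\<Sum>j\<in>D. f j * (x a j + x u j)) = pair f a + pair f u"
        by (simp add: pair_def distrib_left sum.distrib)
      finally show ?thesis using \<psi>_cong \<psi>_add by metis
    qed
    then have "(\<Sum>u\<in>U. \<psi> (pair f u)) = \<psi> (pair f a) * (\<Sum>u\<in>U. \<psi> (pair f u))"
      using sum.reindex_bij_betw[OF bij[OF a(1)], of "\<lambda>u. \<psi> (pair f u)"]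
      by (simp add: sum_distrib_left)
    then have "(\<Sum>u\<in>U. \<psi> (pair f u)) = 0" using a(2) \<psi>_iff by auto
    then show ?thesis unfolding if_not_P[OF False] .
  qed
  have over_F: "(\<Sum>f\<in>?F. \<psi> (pair f u)) = (if u \<in> ?Z then of_nat (nat n ^ card D) else 0)"
    if "u \<in> U" for u
  proof -
    have "(\<Sum>f\<in>?F. \<psi> (pair f u)) = (\<Sum>f\<in>?F. \<Prod>j\<in>D. \<psi> (f j * x u j))"
      by (simp add: pair_def \<psi>_sum fin)
    also have "\<dots> = (\<Prod>j\<in>D. \<Sum>k\<in>{0..<n}. \<psi> (k * x u j))"
      using fin by (subst prod_sum_PiE) auto
    also have "\<dots> = (\<Prod>j\<in>D. if n dvd x u j then of_int n else 0)"
      using sum_roots_of_unity_int[OF n] by (simp add: \<psi>_def)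
    also have "\<dots> = (if u \<in> ?Z then of_nat (nat n ^ card D) else 0)"
      using fin n that by (auto simp: prod_zero_iff)
    finally show ?thesis .
  qed
  have "(of_nat (card ?K * card U) :: complex) = (\<Sum>f\<in>?F. if f \<in> ?K then of_nat (card U) else 0)"
    using finF by (subst sum.inter_filter[symmetric]) (auto intro: arg_cong[where f = card])
  also have "\<dots> = (\<Sum>f\<in>?F. \<Sum>u\<in>U. \<psi> (pair f u))" using over_U by simp
  also have "\<dots> = (\<Sum>u\<in>U. \<Sum>f\<in>?F. \<psi> (pair f u))" by (rule sum.swap)
  also have "\<dots> = (\<Sum>u\<in>U. if u \<in> ?Z then of_nat (nat n ^ card D) else 0)" using over_F by simp
  also have "\<dots> = of_nat (nat n ^ card D * card ?Z)"
    using fin by (subst sum.inter_filter[symmetric]) (auto intro: arg_cong[where f = card])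
  finally have "card ?K * card U = nat n ^ card D * card ?Z" by (simp only: of_nat_eq_iff)
  then show ?thesis by (simp add: pair_def)
qed

text \<open>Subtracting a fixed functional embeds each fibre of the restriction to \<open>U\<close>
  into the annihilator of \<open>U\<close>. Thus \<open>n ^ card D\<close> is at most the number of
  restrictions times the size of the annihilator, which \<open>card_functional_annihilator\<close>
  evaluates.\<close>

lemma card_le_card_functionals:
  fixes n :: int and x :: "'a \<Rightarrow> 'b \<Rightarrow> int"
  assumes n: "n > 0" and fin: "finite D" "finite U"
    and bij: "\<And>a. a \<in> U \<Longrightarrow> bij_betw (s a) U U"
    and add: "\<And>a b j. a \<in> U \<Longrightarrow> b \<in> U \<Longrightarrow> j \<in> D \<Longrightarrow> [x (s a b) j = x a j + x b j] (mod n)"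
  shows "card U \<le> card ((\<lambda>f. \<lambda>u\<in>U. (\<Sum>j\<in>D. f j * x u j) mod n) ` (D \<rightarrow>\<^sub>E {0..<n}))
    * card {u \<in> U. \<forall>j\<in>D. n dvd x u j}"
proof -
  let ?F = "D \<rightarrow>\<^sub>E {0..<n}"
  let ?\<rho> = "\<lambda>f. \<lambda>u\<in>U. (\<Sum>j\<in>D. f j * x u j) mod n"
  let ?K = "{f \<in> ?F. \<forall>u\<in>U. n dvd (\<Sum>j\<in>D. f j * x u j)}"
  let ?Z = "{u \<in> U. \<forall>j\<in>D. n dvd x u j}"
  have finF: "finite ?F" using fin by (intro finite_PiE) auto
  have cardF: "card ?F = nat n ^ card D" using fin by (simp add: card_PiE)
  have fiber: "card {f \<in> ?F. ?\<rho> f = ?\<rho> f0} \<le> card ?K" if f0: "f0 \<in> ?F" for f0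
  proof (rule card_inj_on_le)
    \<comment> \<open>The difference is reduced modulo \<open>n\<close> so that it lies in
      \<open>?F\<close> again.\<close>
    let ?h = "\<lambda>f. \<lambda>j\<in>D. (f j - f0 j) mod n"
    show "inj_on ?h {f \<in> ?F. ?\<rho> f = ?\<rho> f0}"
    proof (rule inj_onI)
      fix f g assume fg: "f \<in> {f \<in> ?F. ?\<rho> f = ?\<rho> f0}" "g \<in> {f \<in> ?F. ?\<rho> f = ?\<rho> f0}" "?h f = ?h g"
      show "f = g"
      proof (rule PiE_ext)
        show "f \<in> ?F" "g \<in> ?F" using fg by auto
        fix j assume j: "j \<in> D"
        have "(f j - f0 j) mod n = (g j - f0 j) mod n" using fun_cong[OF fg(3), of j] j by simp
        then have "f j mod n = g j mod n" by (simp add: mod_eq_dvd_iff)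
        moreover have "f j \<in> {0..<n}" "g j \<in> {0..<n}" using fg j by auto
        ultimately show "f j = g j" by simp
      qed
    qed
    show "?h ` {f \<in> ?F. ?\<rho> f = ?\<rho> f0} \<subseteq> ?K"
    proof (intro image_subsetI CollectI conjI ballI)
      fix f assume f: "f \<in> {f \<in> ?F. ?\<rho> f = ?\<rho> f0}"
      show "?h f \<in> ?F" using n by auto
      fix u assume u: "u \<in> U"
      have "(\<Sum>j\<in>D. f j * x u j) mod n = (\<Sum>j\<in>D. f0 j * x u j) mod n"
        using f u by (auto dest: fun_cong[of _ _ u])
      then have "n dvd (\<Sum>j\<in>D. (f j - f0 j) * x u j)"
        by (simp add: mod_eq_dvd_iff left_diff_distrib sum_subtractf)
      moreover have "[(\<Sum>j\<in>D. ?h f j * x u j) = (\<Sum>j\<in>D. (f j - f0 j) * x u j)] (mod n)"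
        by (intro cong_sum cong_mult) (auto simp: cong_def)
      ultimately show "n dvd (\<Sum>j\<in>D. ?h f j * x u j)" by (simp add: cong_dvd_iff)
    qed
    show "finite ?K" using finF by simp
  qed
  have "?F = (\<Union>\<phi>\<in>?\<rho> ` ?F. {f \<in> ?F. ?\<rho> f = \<phi>})" by auto
  then have "card ?F \<le> (\<Sum>\<phi>\<in>?\<rho> ` ?F. card {f \<in> ?F. ?\<rho> f = \<phi>})"
    using card_UN_le[of "?\<rho> ` ?F" "\<lambda>\<phi>. {f \<in> ?F. ?\<rho> f = \<phi>}"] finF by simp
  also have "\<dots> \<le> card (?\<rho> ` ?F) * card ?K"
    by (rule sum_bounded_above[of _ _ "card ?K", simplified of_nat_id], erule imageE, simp only: fiber)
  finally have "card ?F * card U \<le> card (?\<rho> ` ?F) * card ?K * card U"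
    by (rule mult_le_mono1)
  then have "nat n ^ card D * card U \<le> card (?\<rho> ` ?F) * (card ?K * card U)"
    by (simp only: cardF mult.assoc)
  also have "card ?K * card U = nat n ^ card D * card ?Z"
    by (rule card_functional_annihilator[OF n fin bij add])
  finally have "nat n ^ card D * card U \<le> nat n ^ card D * (card (?\<rho> ` ?F) * card ?Z)"
    by (simp only: mult.left_commute)
  moreover have "nat n ^ card D > 0" using n by simp
  ultimately show ?thesis by (simp only: nat_mult_le_cancel1)
qed

section \<open>Integer arithmetic: lifting units, Euclid's algorithm, primitive elements\<close>

text \<open>Add to \<open>k\<close> the number \<open>d\<close> times the primes of \<open>n\<close>
  not dividing \<open>k\<close>. A prime of \<open>n\<close> then divides exactly one of the two
  summands: if it divides \<open>k\<close>, it divides neither \<open>d\<close> nor the product of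
  the other primes.\<close>

lemma coprime_lift:
  fixes k d n :: int
  assumes "coprime k d" "n > 0"
  obtains u where "coprime u n" "[u = k] (mod d)"
proof -
  define Q where "Q = {p \<in> prime_factors n. \<not> p dvd k}"
  define u where "u = k + \<Prod>Q * d"
  have "coprime u n"
  proof (rule ccontr)
    assume "\<not> coprime u n"
    then have "\<not> is_unit (gcd u n)" by (simp add: coprime_iff_gcd_eq_1)
    moreover have "gcd u n \<noteq> 0" using assms by simp
    ultimately obtain p where p: "prime p" "p dvd u" "p dvd n"
      using prime_divisor_exists[of "gcd u n"] by auto
    show False
    proof (cases "p dvd k")
      case True
      then have "p dvd \<Prod>Q * d" using p(2) by (simp add: u_def dvd_add_right_iff)
      moreover have "\<not> p dvd d" using True assms(1) p(1) by (meson coprime_common_divisor not_prime_unit)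
      ultimately have "p dvd \<Prod>Q" using p(1) by (simp add: prime_dvd_mult_iff)
      then obtain q where "q \<in> Q" "p dvd q"
        using p(1) prime_dvd_prod_iff[of Q p "\<lambda>x. x"] by (auto simp: Q_def)
      then show False using True p(1) primes_dvd_imp_eq[of p q] by (auto simp: Q_def)
    next
      case False
      then have "p \<in> Q" using p assms by (auto simp: Q_def prime_factors_dvd)
      then have "p dvd \<Prod>Q" using dvd_prodI[of Q p "\<lambda>x. x"] by (auto simp: Q_def)
      then have "p dvd k" using p(2) by (simp add: u_def dvd_add_left_iff)
      with False show False ..
    qed
  qed
  moreover have "[u = k] (mod d)" by (simp add: u_def cong_iff_dvd_diff)
  ultimately show thesis using that by blast
qed

text \<open>Euclid's algorithm, with the sum of absolute values as measure. \<open>Q\<close> is an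
  abstract reflexive and transitive relation containing the steps, so that it can later mean
  reachability by an automorphism.\<close>

lemma euclid_by_elementary_steps:
  fixes Q :: "('b \<Rightarrow> int) \<Rightarrow> ('b \<Rightarrow> int) \<Rightarrow> bool"
  assumes "finite B" "i \<in> B"
    and refl: "\<And>c. Q c c"
    and trans: "\<And>a b c. Q a b \<Longrightarrow> Q b c \<Longrightarrow> Q a c"
    and step: "\<And>c j l k. j \<in> B \<Longrightarrow> l \<in> B \<Longrightarrow> j \<noteq> l \<Longrightarrow> Q c (c(j := c j + k * c l))"
  shows "\<exists>c'. Q c c' \<and> (\<forall>b\<in>B - {i}. c' b = 0)"
proof (induction c rule: measure_induct_rule[where f = "\<lambda>c. \<Sum>b\<in>B. nat \<bar>c b\<bar>"])
  case (less c)
  show ?case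
  proof (cases "\<exists>j\<in>B. \<exists>l\<in>B. j \<noteq> l \<and> c l \<noteq> 0 \<and> \<bar>c l\<bar> \<le> \<bar>c j\<bar>")
    case True
    then obtain j l where jl: "j \<in> B" "l \<in> B" "j \<noteq> l" "c l \<noteq> 0" "\<bar>c l\<bar> \<le> \<bar>c j\<bar>" by blast
    \<comment> \<open>The signs are chosen so that entry \<open>j\<close> moves towards 0 by
      \<open>\<bar>c l\<bar>\<close>, which is at most \<open>\<bar>c j\<bar>\<close>.\<close>
    define c' where "c' = c(j := c j + (- (sgn (c l) * sgn (c j))) * c l)"
    have "\<bar>c' j\<bar> < \<bar>c j\<bar>" using jl by (auto simp: c'_def sgn_if)
    then have "(\<Sum>b\<in>B. nat \<bar>c' b\<bar>) < (\<Sum>b\<in>B. nat \<bar>c b\<bar>)"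
      using assms(1) jl(1) by (intro sum_strict_mono_ex1) (auto simp: c'_def)
    from less[OF this] obtain c'' where "Q c' c''" "\<forall>b\<in>B - {i}. c'' b = 0" by blast
    moreover have "Q c c'" unfolding c'_def by (rule step) (use jl in auto)
    ultimately show ?thesis using trans by blast
  next
    case False
    \<comment> \<open>Of two nonzero entries the smaller could reduce the other, so at most one
      entry is nonzero.\<close>
    then have single: "c l = 0 \<or> c j = 0" if "j \<in> B" "l \<in> B" "j \<noteq> l" for j l
      using that by (metis linorder_linear)
    show ?thesis
    proof (cases "\<forall>b\<in>B - {i}. c b = 0")
      case True
      then show ?thesis using refl by blast
    next
      case False
      then obtain j where j: "j \<in> B" "j \<noteq> i" "c j \<noteq> 0" by blast
      \<comment> \<open>Two steps carry the only nonzero entry from \<open>j\<close> to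
        \<open>i\<close>, where \<open>c\<close> is 0: copy it, then subtract the copy.\<close>
      define c1 where "c1 = c(i := c i + 1 * c j)"
      define c2 where "c2 = c1(j := c1 j + (- 1) * c1 i)"
      have "Q c c1" unfolding c1_def by (rule step) (use j assms(2) in auto)
      moreover have "Q c1 c2" unfolding c2_def by (rule step) (use j assms(2) in auto)
      moreover have "\<forall>b\<in>B - {i}. c2 b = 0"
        using single[OF j(1)] j assms(2) by (auto simp: c2_def c1_def)
      ultimately show ?thesis using trans by blast
    qed
  qed
qed

text \<open>A Chinese remainder argument: in \<open>q * a + \<Prod>P * c\<close> the second term
  vanishes modulo the primes in \<open>P\<close> and the first modulo \<open>q\<close>, so
  \<open>a\<close> decides at the old primes and \<open>c\<close> at the new one.\<close>

lemma exists_primitive_element: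
  fixes L :: "('b \<Rightarrow> int) set" and P :: "int set"
  assumes "finite P" "\<And>p. p \<in> P \<Longrightarrow> prime p"
    and zero: "(\<lambda>_. 0) \<in> L"
    and comb: "\<And>a c k l. a \<in> L \<Longrightarrow> c \<in> L \<Longrightarrow> (\<lambda>b. k * a b + l * c b) \<in> L"
    and "\<And>p. p \<in> P \<Longrightarrow> \<exists>c\<in>L. \<exists>b\<in>B. \<not> p dvd c b"
  shows "\<exists>c\<in>L. \<forall>p\<in>P. \<exists>b\<in>B. \<not> p dvd c b"
  using assms(1,2,5)
proof (induction P)
  case empty
  then show ?case using zero by blast
next
  case (insert q P)
  obtain a where a: "a \<in> L" "\<forall>p\<in>P. \<exists>b\<in>B. \<not> p dvd a b" using insert by auto
  obtain c where c: "c \<in> L" "\<exists>b\<in>B. \<not> q dvd c b" using insert.prems(2)[of q] by blast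
  have q: "prime q" using insert.prems by simp
  have ndvd: "\<not> p dvd q" "\<not> q dvd p" if "p \<in> P" for p
    using that insert q primes_dvd_imp_eq[of p q] primes_dvd_imp_eq[of q p] by auto
  have ndvd': "\<not> q dvd \<Prod>P"
    using prime_dvd_prod_iff[of P q "\<lambda>x. x"] insert.hyps q ndvd by auto
  have dvd: "p dvd \<Prod>P" if "p \<in> P" for p
    using dvd_prodI[OF insert.hyps(1) that, of "\<lambda>x. x"] .
  let ?e = "\<lambda>b. q * a b + \<Prod>P * c b"
  have "\<exists>b\<in>B. \<not> p dvd ?e b" if "p \<in> P" for p
  proof -
    from bspec[OF a(2) that] obtain b where "b \<in> B" and b: "\<not> p dvd a b" by (rule bexE)
    note b
    moreover have "prime p" using insert.prems(1) that by blast
    ultimately have "\<not> p dvd q * a b" using ndvd(1)[OF that] prime_dvd_mult_iff by blast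
    moreover have "p dvd \<Prod>P * c b" using dvd[OF that] by (rule dvd_mult2)
    ultimately have "\<not> p dvd ?e b" using dvd_add_left_iff[of p "\<Prod>P * c b" "q * a b"] by blast
    with \<open>b \<in> B\<close> show ?thesis by blast
  qed
  moreover have "\<exists>b\<in>B. \<not> q dvd ?e b"
  proof -
    from c(2) obtain b where "b \<in> B" "\<not> q dvd c b" by (rule bexE)
    from this(2) have "\<not> q dvd \<Prod>P * c b" using ndvd' prime_dvd_mult_iff[OF q] by blast
    moreover have "q dvd q * a b" by (rule dvd_triv_left)
    ultimately have "\<not> q dvd ?e b" using dvd_add_right_iff[of q "q * a b" "\<Prod>P * c b"] by blast
    with \<open>b \<in> B\<close> show ?thesis by blast
  qed
  ultimately have "\<forall>p\<in>insert q P. \<exists>b\<in>B. \<not> p dvd ?e b" by (auto simp only: insert_iff)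
  then show ?case by (rule bexI[where x = ?e]) (rule comb[OF a(1) c(1)])
qed

section \<open>Coordinates on a free module over \<open>residue_ring n\<close> and its automorphism
  group\<close>

locale free_residue_module = module "residue_ring n" V
  for n :: int and V :: "(int, 'v, 'z) module_scheme" (structure) +
  fixes B :: "'v set"
  assumes n_gt_1: "n > 1" and basis: "module_basis (residue_ring n) V B"
begin

abbreviation "G \<equiv> module_Aut (residue_ring n) V"

text \<open>Coordinates are arbitrary integers, reduced only here, so that computations with them
  run in \<open>int\<close> and equality of vectors becomes congruence modulo
  \<open>n\<close>.\<close>

definition vec :: "('v \<Rightarrow> int) \<Rightarrow> 'v" where
  "vec c = (\<Oplus>b\<in>B. (c b mod n) \<odot> b)"

lemma finite_basis: "finite B" and basis_subset: "B \<subseteq> carrier V"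
  using basis by (auto simp: module_basis_def)

lemma residue_simps [simp]:
  "carrier (residue_ring n) = {0..<n}" "x \<oplus>\<^bsub>residue_ring n\<^esub> y = (x + y) mod n"
  "x \<otimes>\<^bsub>residue_ring n\<^esub> y = (x * y) mod n"
  by (auto simp: residue_ring_def)

lemma mod_in_carrier: "k mod n \<in> carrier (residue_ring n)"
  using n_gt_1 by simp

lemma vec_closed [simp, intro]: "vec c \<in> carrier V"
  unfolding vec_def using basis_subset mod_in_carrier by (intro M.finsum_closed) (auto simp del: residue_simps)

lemma vec_cong: "vec c = vec c'" if "\<And>b. b \<in> B \<Longrightarrow> [c b = c' b] (mod n)"
  unfolding vec_def
  by (rule M.finsum_cong') (use that basis_subset mod_in_carrier in
      \<open>auto simp: cong_def simp del: residue_simps\<close>)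

lemma vec_eq_iff: "vec c = vec c' \<longleftrightarrow> (\<forall>b\<in>B. [c b = c' b] (mod n))"
proof
  assume eq: "vec c = vec c'"
  \<comment> \<open>Uniqueness in \<open>module_basis\<close> concerns extensional coordinate
    functions with reduced values, so \<open>vec\<close> is first rewritten in that form.\<close>
  have norm: "vec c = (\<Oplus>b\<in>B. (\<lambda>b\<in>B. c b mod n) b \<odot> b)" for c
    unfolding vec_def by (rule M.finsum_cong') (use basis_subset mod_in_carrier in
        \<open>auto simp del: residue_simps\<close>)
  have mem: "(\<lambda>b\<in>B. c b mod n) \<in> B \<rightarrow>\<^sub>E carrier (residue_ring n)" for c
    using n_gt_1 by auto
  have "\<exists>!x. x \<in> B \<rightarrow>\<^sub>E carrier (residue_ring n) \<and> vec c = (\<Oplus>b\<in>B. x b \<odot> b)"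
    using basis vec_closed unfolding module_basis_def by blast
  then have "(\<lambda>b\<in>B. c b mod n) = (\<lambda>b\<in>B. c' b mod n)"
    using norm mem eq by metis
  then have "c b mod n = c' b mod n" if "b \<in> B" for b
    using that by (metis restrict_apply')
  then show "\<forall>b\<in>B. [c b = c' b] (mod n)" by (simp add: cong_def)
qed (simp add: vec_cong)

lemma vec_surj:
  assumes "v \<in> carrier V"
  obtains c where "c \<in> B \<rightarrow>\<^sub>E {0..<n}" "v = vec c"
proof -
  obtain c where c: "c \<in> B \<rightarrow>\<^sub>E carrier (residue_ring n)" "v = (\<Oplus>b\<in>B. c b \<odot> b)"
    using basis assms unfolding module_basis_def by blast
  have "c b mod n = c b" if "b \<in> B" for b using c(1) that by (auto simp: PiE_iff)
  then have "v = vec c"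
    unfolding c(2) vec_def
    by (intro M.finsum_cong') (use c(1) basis_subset in \<open>auto simp: PiE_iff\<close>)
  with c(1) show thesis using that by simp
qed

lemma vec_add: "vec c \<oplus> vec c' = vec (\<lambda>b. c b + c' b)"
proof -
  have "vec (\<lambda>b. c b + c' b) = (\<Oplus>b\<in>B. (c b mod n) \<odot> b \<oplus> (c' b mod n) \<odot> b)"
    unfolding vec_def
  proof (rule M.finsum_cong')
    show "(\<lambda>b. (c b mod n) \<odot> b \<oplus> (c' b mod n) \<odot> b) \<in> B \<rightarrow> carrier V"
      using basis_subset mod_in_carrier by (auto simp del: residue_simps)
    show "((c b + c' b) mod n) \<odot> b = (c b mod n) \<odot> b \<oplus> (c' b mod n) \<odot> b" if "b \<in> B" for b
      using smult_l_distr[OF mod_in_carrier[of "c b"] mod_in_carrier[of "c' b"], of b]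
        that basis_subset by (auto simp: mod_add_eq)
  qed simp
  also have "\<dots> = vec c \<oplus> vec c'"
    unfolding vec_def using basis_subset mod_in_carrier
    by (intro M.finsum_addf) (auto simp del: residue_simps)
  finally show ?thesis ..
qed

lemma vec_smult: "(k mod n) \<odot> vec c = vec (\<lambda>b. k * c b)"
proof -
  have "(k mod n) \<odot> vec c = (\<Oplus>b\<in>B. (k mod n) \<odot> ((c b mod n) \<odot> b))"
    unfolding vec_def using basis_subset mod_in_carrier finite_basis
    by (intro finsum_smult_ldistr) (auto simp del: residue_simps)
  also have "\<dots> = vec (\<lambda>b. k * c b)"
    unfolding vec_def
  proof (rule M.finsum_cong')
    show "(\<lambda>b. (k * c b mod n) \<odot> b) \<in> B \<rightarrow> carrier V"
      using basis_subset mod_in_carrier by (auto simp del: residue_simps)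
    show "(k mod n) \<odot> ((c b mod n) \<odot> b) = (k * c b mod n) \<odot> b" if "b \<in> B" for b
      using smult_assoc1[OF mod_in_carrier[of k] mod_in_carrier[of "c b"], of b]
        that basis_subset by (auto simp: mod_mult_eq)
  qed simp
  finally show ?thesis .
qed

lemma finite_carrier: "finite (carrier V)"
proof -
  have "carrier V \<subseteq> vec ` (B \<rightarrow>\<^sub>E {0..<n})" using vec_surj by blast
  then show ?thesis by (rule finite_subset) (use finite_basis in \<open>auto intro!: finite_PiE\<close>)
qed

lemma carrier_G: "carrier G = linear_automorphisms (residue_ring n) V"
  by (simp add: module_Aut_def)

lemma G_Bij: "g \<in> carrier G \<Longrightarrow> g \<in> Bij (carrier V)"
  by (simp add: carrier_G linear_automorphisms_def)

lemma G_closed: "g \<in> carrier G \<Longrightarrow> v \<in> carrier V \<Longrightarrow> g v \<in> carrier V"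
  by (rule funcset_mem[OF Bij_imp_funcset[OF G_Bij]])

lemma G_inj: "g \<in> carrier G \<Longrightarrow> v \<in> carrier V \<Longrightarrow> w \<in> carrier V \<Longrightarrow> g v = g w \<Longrightarrow> v = w"
  using G_Bij[of g] inj_onD[of g "carrier V" v w] by (simp add: Bij_def bij_betw_def)

lemma G_add: "g \<in> carrier G \<Longrightarrow> v \<in> carrier V \<Longrightarrow> w \<in> carrier V \<Longrightarrow> g (v \<oplus> w) = g v \<oplus> g w"
  by (simp add: carrier_G linear_automorphisms_def)

lemma G_scale:
  assumes "g \<in> carrier G" "g (vec c) = vec c'"
  shows "g (vec (\<lambda>b. k * c b)) = vec (\<lambda>b. k * c' b)"
proof -
  have "g ((k mod n) \<odot> vec c) = (k mod n) \<odot> g (vec c)"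
    using assms(1) mod_in_carrier[of k] vec_closed[of c]
    by (simp add: carrier_G linear_automorphisms_def del: residue_simps)
  then show ?thesis by (simp add: vec_smult assms(2))
qed

sublocale G: group G
  by (rule group_module_Aut)

lemma G_mult:
  assumes "g \<in> carrier G" "h \<in> carrier G" "v \<in> carrier V"
  shows "(g \<otimes>\<^bsub>G\<^esub> h) v = g (h v)"
  using G_Bij[OF assms(1)] G_Bij[OF assms(2)] assms(3)
  by (simp add: module_Aut_def BijGroup_def compose_def)

lemma G_one: "v \<in> carrier V \<Longrightarrow> \<one>\<^bsub>G\<^esub> v = v"
  by (simp add: module_Aut_def BijGroup_def)

lemma G_inv:
  assumes "g \<in> carrier G" "v \<in> carrier V"
  shows "(inv\<^bsub>G\<^esub> g) (g v) = v"
  using G_mult[OF G.inv_closed[OF assms(1)] assms] G.l_inv[OF assms(1)] G_one[OF assms(2)] by simp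

lemma finite_G: "finite (carrier G)"
proof (rule finite_subset)
  show "carrier G \<subseteq> carrier V \<rightarrow>\<^sub>E carrier V"
    unfolding PiE_def by (intro subsetI IntI Bij_imp_funcset Bij_imp_extensional G_Bij)
qed (use finite_carrier in \<open>auto intro!: finite_PiE\<close>)

section \<open>Row operations and transitivity on vectors of a given order\<close>

text \<open>The action on coordinates of a matrix that differs from the identity only in row
  \<open>i\<close>, with diagonal entry \<open>u\<close> and entries \<open>f\<close> elsewhere. For
  \<open>u = 1\<close> these are transvections, for \<open>f = 0\<close> scalings of one
  coordinate.\<close>

definition row_map :: "'v \<Rightarrow> int \<Rightarrow> ('v \<Rightarrow> int) \<Rightarrow> ('v \<Rightarrow> int) \<Rightarrow> 'v \<Rightarrow> int" where
  "row_map i u f c = c(i := u * c i + (\<Sum>j\<in>B - {i}. f j * c j))"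

lemma row_map_cong:
  assumes "i \<in> B" "\<And>b. b \<in> B \<Longrightarrow> [c b = c' b] (mod n)" "b \<in> B"
  shows "[row_map i u f c b = row_map i u f c' b] (mod n)"
proof (cases "b = i")
  case True
  have "[u * c i + (\<Sum>j\<in>B - {i}. f j * c j) = u * c' i + (\<Sum>j\<in>B - {i}. f j * c' j)] (mod n)"
    by (intro cong_add cong_mult cong_sum cong_refl assms) auto
  then show ?thesis by (simp add: row_map_def True)
qed (simp add: row_map_def assms)

lemma row_map_add: "row_map i u f (\<lambda>b. c b + c' b) = (\<lambda>b. row_map i u f c b + row_map i u f c' b)"
  by (rule ext) (simp add: row_map_def distrib_left sum.distrib)

lemma row_map_scale: "row_map i u f (\<lambda>b. k * c b) = (\<lambda>b. k * row_map i u f c b)"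
  by (rule ext) (simp add: row_map_def distrib_left sum_distrib_left mult.left_commute)

lemma row_map_row_map:
  "row_map i u' f' (row_map i u f c) =
    c(i := u' * u * c i + (\<Sum>j\<in>B - {i}. (u' * f j + f' j) * c j))"
proof -
  have "(\<Sum>j\<in>B - {i}. f' j * row_map i u f c j) = (\<Sum>j\<in>B - {i}. f' j * c j)"
    by (rule sum.cong) (simp_all add: row_map_def)
  then have "row_map i u' f' (row_map i u f c) i
      = u' * (u * c i + (\<Sum>j\<in>B - {i}. f j * c j)) + (\<Sum>j\<in>B - {i}. f' j * c j)"
    by (simp add: row_map_def)
  also have "\<dots> = u' * u * c i + (\<Sum>j\<in>B - {i}. (u' * f j + f' j) * c j)"
    by (simp add: distrib_right distrib_left sum.distrib sum_distrib_left mult.assoc)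
  finally show ?thesis
    by (intro ext) (simp add: row_map_def)
qed

text \<open>For \<open>u'\<close> inverse to \<open>u\<close> modulo \<open>n\<close>, the row map
  with diagonal entry \<open>u'\<close> and other entries \<open>- u' * f j\<close> is a two-sided
  inverse modulo \<open>n\<close>.\<close>

lemma exists_row_automorphism:
  assumes i: "i \<in> B" and "coprime u n"
  shows "\<exists>g\<in>carrier G. \<forall>c. g (vec c) = vec (row_map i u f c)"
proof -
  obtain u' where u': "[u * u' = 1] (mod n)" using assms(2) cong_solve_coprime_int by blast
  \<comment> \<open>Any choice of integer coordinates serves: by \<open>row_map_cong\<close> the
    image does not depend on it.\<close>
  define coord where "coord v = (SOME c. vec c = v)" for v
  have coord: "vec (coord v) = v" if vV: "v \<in> carrier V" for v
  proof -
    obtain c where "v = vec c" using vec_surj[OF vV] by blast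
    then show ?thesis unfolding coord_def by (intro someI_ex[of "\<lambda>c. vec c = v"] exI[of _ c]) simp
  qed
  define \<Phi> where "\<Phi> u f = (\<lambda>v\<in>carrier V. vec (row_map i u f (coord v)))" for u f
  have \<Phi>: "\<Phi> u f (vec c) = vec (row_map i u f c)" for u f c
  proof -
    have "\<Phi> u f (vec c) = vec (row_map i u f (coord (vec c)))" by (simp add: \<Phi>_def)
    also have "\<dots> = vec (row_map i u f c)"
      using coord[OF vec_closed, of c] by (intro vec_cong row_map_cong i) (auto simp: vec_eq_iff)
    finally show ?thesis .
  qed
  let ?g = "\<Phi> u f" and ?h = "\<Phi> u' (\<lambda>j. - u' * f j)"
  have hg: "?h (?g v) = v" if vV: "v \<in> carrier V" for v
  proof -
    obtain c where v: "v = vec c" using vec_surj[OF vV] by blast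
    have "[u' * u * c i = 1 * c i] (mod n)" using u' by (intro cong_mult) (auto simp: mult.commute)
    then show ?thesis unfolding v \<Phi> row_map_row_map by (intro vec_cong) auto
  qed
  have gh: "?g (?h v) = v" if vV: "v \<in> carrier V" for v
  proof -
    obtain c where v: "v = vec c" using vec_surj[OF vV] by blast
    have 1: "[u * u' * c i = 1 * c i] (mod n)" using u' by (intro cong_mult) auto
    \<comment> \<open>In this order the off-diagonal entries cancel only modulo \<open>n\<close>,
      through the factor \<open>1 - u * u'\<close>.\<close>
    have 2: "[(u * (- u' * f j) + f j) * c j = 0] (mod n)" for j
    proof -
      have "n dvd 1 - u * u'" using u' by (simp add: cong_iff_dvd_diff dvd_diff_commute)
      moreover have "(u * (- u' * f j) + f j) * c j = (1 - u * u') * (f j * c j)"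
        by (simp add: algebra_simps)
      ultimately show ?thesis by (simp only: cong_0_iff dvd_mult2)
    qed
    have "[u * u' * c i + (\<Sum>j\<in>B - {i}. (u * (- u' * f j) + f j) * c j)
        = 1 * c i + (\<Sum>j\<in>B - {i}. 0)] (mod n)"
      by (intro cong_add cong_sum 1 2)
    then have "[(c(i := u * u' * c i + (\<Sum>j\<in>B - {i}. (u * (- u' * f j) + f j) * c j))) b = c b] (mod n)"
      for b by simp
    then show ?thesis unfolding v \<Phi> row_map_row_map by (intro vec_cong)
  qed
  have "\<Phi> u f \<in> carrier V \<rightarrow> carrier V" for u f by (simp add: \<Phi>_def)
  then have "bij_betw ?g (carrier V) (carrier V)"
    by (intro bij_betwI[where g = ?h] hg gh)
  then have "?g \<in> Bij (carrier V)" by (simp add: Bij_def \<Phi>_def)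
  moreover have "?g (v \<oplus> w) = ?g v \<oplus> ?g w" if v: "v \<in> carrier V" and w: "w \<in> carrier V" for v w
  proof -
    obtain c where c: "v = vec c" using vec_surj[OF v] by blast
    obtain d where d: "w = vec d" using vec_surj[OF w] by blast
    show ?thesis by (simp only: c d vec_add \<Phi> row_map_add)
  qed
  moreover have "?g (a \<odot> v) = a \<odot> ?g v" if a: "a \<in> carrier (residue_ring n)" and v: "v \<in> carrier V" for a v
  proof -
    obtain c where c: "v = vec c" using vec_surj[OF v] by blast
    have "a = a mod n" using a by simp
    then have smult: "a \<odot> vec c = vec (\<lambda>b. a * c b)" for c using vec_smult[of a c] by simp
    show ?thesis by (simp only: c smult \<Phi> row_map_scale)
  qed
  ultimately have "?g \<in> carrier G" by (simp add: carrier_G linear_automorphisms_def)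
  then show ?thesis using \<Phi> by (intro bexI[of _ ?g] allI)
qed

text \<open>
  Column reduction over the integers brings \<open>c\<close> to a multiple \<open>k\<close> of the basis vector \<open>i\<close>, with
  \<open>k\<close> prime to \<open>d\<close>; lifting \<open>k\<close> to a unit modulo \<open>n\<close> normalizes it to \<open>1\<close>.
\<close>

lemma order_d_vectors_transitive:
  assumes i: "i \<in> B" and d: "d > 0" "d dvd n"
    and prim: "\<And>p. prime p \<Longrightarrow> p dvd d \<Longrightarrow> \<exists>b\<in>B. \<not> p dvd c b"
  shows "\<exists>g\<in>carrier G. g (vec (\<lambda>b. (n div d) * c b)) = vec (\<lambda>b. if b = i then n div d else 0)"
proof -
  define Q where "Q c c' \<longleftrightarrow> (\<exists>g\<in>carrier G. g (vec c) = vec c')" for c c'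
  have "\<exists>c'. Q c c' \<and> (\<forall>b\<in>B - {i}. c' b = 0)"
  proof (rule euclid_by_elementary_steps[OF finite_basis i])
    show "Q c c" for c unfolding Q_def by (intro bexI[of _ "\<one>\<^bsub>G\<^esub>"] G_one vec_closed G.one_closed)
    show "Q a c" if ab: "Q a b" and bc: "Q b c" for a b c
    proof -
      obtain g where "g \<in> carrier G" "g (vec a) = vec b" using ab unfolding Q_def by blast
      moreover obtain h where "h \<in> carrier G" "h (vec b) = vec c" using bc unfolding Q_def by blast
      ultimately show ?thesis unfolding Q_def by (intro bexI[of _ "h \<otimes>\<^bsub>G\<^esub> g"]) (simp_all add: G_mult)
    qed
    fix c :: "'v \<Rightarrow> int" and j l :: 'v and k :: int
    assume jl: "j \<in> B" "l \<in> B" "j \<noteq> l"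
    \<comment> \<open>An elementary step is the transvection in row \<open>j\<close> whose
      off-diagonal entries vanish except for \<open>k\<close> at \<open>l\<close>.\<close>
    let ?f = "\<lambda>x. if x = l then k else 0"
    have "(\<Sum>x\<in>B - {j}. ?f x * c x) = (\<Sum>x\<in>B - {j}. if x = l then k * c x else 0)"
      by (intro sum.cong) auto
    also have "\<dots> = k * c l" using finite_basis jl by (subst sum.delta) auto
    finally have "row_map j 1 ?f c = c(j := c j + k * c l)" by (simp add: row_map_def)
    then show "Q c (c(j := c j + k * c l))"
      using exists_row_automorphism[OF jl(1), of 1 ?f] unfolding Q_def by (metis coprime_1_left)
  qed
  then obtain g c' where g: "g \<in> carrier G" "g (vec c) = vec c'" and c': "\<forall>b\<in>B - {i}. c' b = 0"
    unfolding Q_def by blast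
  \<comment> \<open>Automorphisms preserve primitivity: if \<open>p\<close> divided both numbers,
    \<open>n div p\<close> would annihilate \<open>vec c'\<close>, hence \<open>vec c\<close> by
    injectivity of \<open>g\<close>, and then \<open>p\<close> would divide every entry of
    \<open>c\<close>.\<close>
  have "coprime (c' i) d"
  proof (rule ccontr)
    assume "\<not> coprime (c' i) d"
    then have "\<not> is_unit (gcd (c' i) d)" by (simp add: coprime_iff_gcd_eq_1)
    moreover have "gcd (c' i) d \<noteq> 0" using d by simp
    ultimately obtain p where p: "prime p" "p dvd c' i" "p dvd d"
      using prime_divisor_exists[of "gcd (c' i) d"] by auto
    then have "p dvd n" using d by (meson dvd_trans)
    then obtain q where q: "n = p * q" by (rule dvdE)
    have "q \<noteq> 0" using q n_gt_1 by auto
    have "g (vec (\<lambda>b. q * c b)) = vec (\<lambda>b. q * c' b)" by (rule G_scale[OF g])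
    also have "\<dots> = vec (\<lambda>b. 0 * c' b)"
    proof (rule vec_cong)
      fix b assume b: "b \<in> B"
      have "p dvd c' b" using c' p(2) b by (cases "b = i") auto
      then have "p * q dvd c' b * q" by (rule mult_dvd_mono) simp
      then show "[q * c' b = 0 * c' b] (mod n)" by (simp add: cong_0_iff q mult.commute)
    qed
    also have "\<dots> = g (vec (\<lambda>b. 0 * c b))" by (rule G_scale[OF g, symmetric])
    finally have "vec (\<lambda>b. q * c b) = vec (\<lambda>b. 0 * c b)" by (rule G_inj[OF g(1) vec_closed vec_closed])
    then have "\<forall>b\<in>B. p * q dvd c b * q"
      by (simp add: vec_eq_iff cong_0_iff flip: q) (simp add: mult.commute)
    then have "\<forall>b\<in>B. p dvd c b" using \<open>q \<noteq> 0\<close> by simp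
    then show False using prim[OF p(1,3)] by blast
  qed
  then obtain u where u: "coprime u n" "[u = c' i] (mod d)"
    using coprime_lift[of "c' i" d n] n_gt_1 by auto
  obtain h where h: "h \<in> carrier G" "\<And>c. h (vec c) = vec (row_map i u (\<lambda>_. 0) c)"
    using exists_row_automorphism[OF i u(1)] by blast
  let ?e = "\<lambda>b. if b = i then n div d else 0"
  \<comment> \<open>A congruence modulo \<open>d\<close> becomes one modulo \<open>n\<close> after
    multiplication by \<open>n div d\<close>. So \<open>h\<close> sends the normal form to the image
    under \<open>g\<close>, and \<open>g\<close> followed by the inverse of \<open>h\<close> is the
    required automorphism.\<close>
  have "[u * (n div d) = n div d * c' i] (mod n)"
  proof -
    have "d * (n div d) dvd (u - c' i) * (n div d)"
      using u(2) by (intro mult_dvd_mono) (auto simp: cong_iff_dvd_diff)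
    then show ?thesis using d by (simp add: cong_iff_dvd_diff algebra_simps)
  qed
  then have "[row_map i u (\<lambda>_. 0) ?e b = n div d * c' b] (mod n)" if "b \<in> B" for b
    using c' that by (cases "b = i") (simp_all add: row_map_def)
  then have "h (vec ?e) = vec (\<lambda>b. (n div d) * c' b)"
    unfolding h(2) by (rule vec_cong)
  also have "\<dots> = g (vec (\<lambda>b. (n div d) * c b))" by (rule G_scale[OF g, symmetric])
  finally have "(inv\<^bsub>G\<^esub> h \<otimes>\<^bsub>G\<^esub> g) (vec (\<lambda>b. (n div d) * c b)) = vec ?e"
    using G_inv[OF h(1), of "vec ?e"] g h by (simp add: G_mult)
  then show ?thesis using g h by (intro bexI[of _ "inv\<^bsub>G\<^esub> h \<otimes>\<^bsub>G\<^esub> g"]) simp_all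
qed

section \<open>The index as a bound for the number of restrictions\<close>

text \<open>If \<open>\<gamma> \<otimes> inv h\<close> represents the coset of \<open>inv h\<close>,
  then \<open>h\<close> is the inverse of this representative times \<open>\<gamma>\<close>. Hence
  the coset and the restriction of \<open>\<gamma>\<close> determine the restriction of
  \<open>h\<close>. Inverses occur because the cosets have the form
  \<open>\<Gamma> #> x\<close>.\<close>

lemma card_restrictions_le_index:
  assumes \<Gamma>: "subgroup \<Gamma> G" and U: "U \<subseteq> carrier V"
  shows "card ((\<lambda>h. restrict h U) ` carrier G)
    \<le> subgroup_index G \<Gamma> * card ((\<lambda>\<gamma>. restrict \<gamma> U) ` \<Gamma>)"
proof -
  let ?Res = "\<lambda>H. (\<lambda>h. restrict h U) ` H"
  define rep where "rep C = (SOME x. x \<in> C)" for C :: "('v \<Rightarrow> 'v) set"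
  let ?m = "\<lambda>(C, \<phi>). \<lambda>v\<in>U. (inv\<^bsub>G\<^esub> rep C) (\<phi> v)"
  have \<Gamma>G: "\<Gamma> \<subseteq> carrier G" using \<Gamma> by (rule subgroup.subset)
  have fin: "finite (rcosets\<^bsub>G\<^esub> \<Gamma>)" "finite \<Gamma>"
    using finite_G finite_subset[OF \<Gamma>G] by (simp_all add: RCOSETS_def)
  have "?Res (carrier G) \<subseteq> ?m ` ((rcosets\<^bsub>G\<^esub> \<Gamma>) \<times> ?Res \<Gamma>)"
  proof (rule image_subsetI)
    fix h assume h: "h \<in> carrier G"
    let ?C = "\<Gamma> #>\<^bsub>G\<^esub> (inv\<^bsub>G\<^esub> h)"
    have C: "?C \<in> rcosets\<^bsub>G\<^esub> \<Gamma>" using h \<Gamma>G by (simp add: G.rcosetsI)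
    have "inv\<^bsub>G\<^esub> h \<in> ?C" by (rule G.rcos_self[OF _ \<Gamma>]) (simp add: h)
    then have "rep ?C \<in> ?C" unfolding rep_def by (rule someI[of "\<lambda>x. x \<in> ?C"])
    then obtain \<gamma> where \<gamma>: "\<gamma> \<in> \<Gamma>" "rep ?C = \<gamma> \<otimes>\<^bsub>G\<^esub> inv\<^bsub>G\<^esub> h"
      by (auto simp: r_coset_def)
    have \<gamma>G: "\<gamma> \<in> carrier G" using \<gamma>(1) \<Gamma>G by (rule subsetD[rotated])
    have "inv\<^bsub>G\<^esub> rep ?C = h \<otimes>\<^bsub>G\<^esub> inv\<^bsub>G\<^esub> \<gamma>"
      using h \<gamma>G by (simp add: \<gamma>(2) G.inv_mult_group)
    then have inv: "inv\<^bsub>G\<^esub> rep ?C \<in> carrier G" "inv\<^bsub>G\<^esub> rep ?C \<otimes>\<^bsub>G\<^esub> \<gamma> = h"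
      using h \<gamma>G by (simp_all add: G.m_assoc)
    have "restrict h U = ?m (?C, restrict \<gamma> U)"
    proof
      fix v show "restrict h U v = ?m (?C, restrict \<gamma> U) v"
        using G_mult[OF inv(1) \<gamma>G, of v] inv(2) U by (cases "v \<in> U") auto
    qed
    then show "restrict h U \<in> ?m ` ((rcosets\<^bsub>G\<^esub> \<Gamma>) \<times> ?Res \<Gamma>)"
      by (rule image_eqI) (intro SigmaI C imageI \<gamma>(1))
  qed
  then have "card (?Res (carrier G)) \<le> card (?m ` ((rcosets\<^bsub>G\<^esub> \<Gamma>) \<times> ?Res \<Gamma>))"
    by (rule card_mono[rotated]) (intro finite_imageI finite_cartesian_product fin)
  also have "\<dots> \<le> card ((rcosets\<^bsub>G\<^esub> \<Gamma>) \<times> ?Res \<Gamma>)"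
    by (rule card_image_le) (intro finite_imageI finite_cartesian_product fin)
  finally show ?thesis by (simp add: subgroup_index_def card_cartesian_product)
qed

section \<open>The exponent of a submodule and the vectors of that order\<close>

text \<open>\<open>d\<close> is the exponent of \<open>W\<close>. For a prime \<open>p\<close>
  dividing \<open>d\<close>, minimality gives a vector of \<open>W\<close> not annihilated by
  \<open>d div p\<close>, that is, one whose coordinates divided by \<open>n div d\<close> are not
  all divisible by \<open>p\<close>; \<open>exists_primitive_element\<close> merges these into a
  single vector of order \<open>d\<close>.\<close>

lemma exists_exponent_vector:
  assumes "submodule W (residue_ring n) V"
  obtains d c where "d > 0" "d dvd n" "\<forall>c. vec c \<in> W \<longrightarrow> (\<forall>b\<in>B. n div d dvd c b)"
    "vec (\<lambda>b. (n div d) * c b) \<in> W" "\<forall>p. prime p \<longrightarrow> p dvd d \<longrightarrow> (\<exists>b\<in>B. \<not> p dvd c b)"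
proof -
  define K where "K k \<longleftrightarrow> k > 0 \<and> (\<forall>c. vec c \<in> W \<longrightarrow> (\<forall>b\<in>B. n dvd k * c b))" for k :: int
  define d where "d = int (LEAST k. K (int k))"
  have "K (int (nat n))" using n_gt_1 by (simp add: K_def)
  then have "K d" unfolding d_def by (rule LeastI)
  have min: "\<not> K k" if k: "0 < k" "k < d" for k
  proof
    assume "K k"
    then have "(LEAST k. K (int k)) \<le> nat k" using k by (intro Least_le) simp
    then show False using k by (simp add: d_def)
  qed
  have d: "d > 0" "\<And>c b. vec c \<in> W \<Longrightarrow> b \<in> B \<Longrightarrow> n dvd d * c b"
    using \<open>K d\<close> by (simp_all add: K_def)
  have "d dvd n"
  proof (rule ccontr)
    assume "\<not> d dvd n"
    \<comment> \<open>The remainder \<open>n mod d\<close> would also annihilate \<open>W\<close>,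
      against the minimality of \<open>d\<close>.\<close>
    then have pos: "0 < n mod d" using d(1) by (simp add: dvd_eq_mod_eq_0 order_less_le)
    have "n dvd (n mod d) * c b" if "vec c \<in> W" "b \<in> B" for c b
    proof -
      have "(n mod d) * c b = n * c b - (n div d) * (d * c b)"
        by (simp add: minus_div_mult_eq_mod[symmetric] algebra_simps)
      then show ?thesis using d(2)[OF that] by simp
    qed
    then have "K (n mod d)" using pos by (simp add: K_def)
    moreover have "n mod d < d" using d(1) by simp
    ultimately show False using min[OF pos] by simp
  qed
  define e where "e = n div d"
  have n: "n = d * e" using \<open>d dvd n\<close> by (simp add: e_def)
  have "e > 0" using zero_less_mult_pos[of d e] n n_gt_1 d(1) by linarith
  have e_dvd: "e dvd c b" if "vec c \<in> W" "b \<in> B" for c b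
    using d(2)[OF that] d(1) by (simp add: n)
  interpret W: submodule W "residue_ring n" V by (rule assms)
  have "\<exists>c\<in>{c. vec (\<lambda>b. e * c b) \<in> W}. \<forall>p\<in>prime_factors d. \<exists>b\<in>B. \<not> p dvd c b"
  proof (rule exists_primitive_element)
    have "\<zero> \<in> W" using W.one_closed by simp
    have smult: "vec (\<lambda>b. k * c b) \<in> W" if "vec c \<in> W" for k c
      using W.smult_closed[OF mod_in_carrier that, of k] by (simp add: vec_smult)
    obtain c0 where c0: "\<zero> = vec c0" using vec_surj[OF M.zero_closed] by blast
    have "vec (\<lambda>b. 0 * c0 b) \<in> W" by (rule smult) (simp flip: c0 add: \<open>\<zero> \<in> W\<close>)
    then show "(\<lambda>_. 0) \<in> {c. vec (\<lambda>b. e * c b) \<in> W}" by simp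
    fix a c k l assume a: "a \<in> {c. vec (\<lambda>b. e * c b) \<in> W}" and c: "c \<in> {c. vec (\<lambda>b. e * c b) \<in> W}"
    have "vec (\<lambda>b. k * (e * a b)) \<in> W" "vec (\<lambda>b. l * (e * c b)) \<in> W"
      using smult a c by simp_all
    then have "vec (\<lambda>b. k * (e * a b)) \<oplus> vec (\<lambda>b. l * (e * c b)) \<in> W"
      using W.m_closed by simp
    then show "(\<lambda>b. k * a b + l * c b) \<in> {c. vec (\<lambda>b. e * c b) \<in> W}"
      by (simp add: vec_add distrib_left mult.left_commute)
  next
    fix p assume p: "p \<in> prime_factors d"
    then have pp: "prime p" "p dvd d" by auto
    have "p > 0" by (rule prime_gt_0_int[OF pp(1)])
    from pp(2) obtain d' where d': "d = p * d'" by (rule dvdE)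
    have "d' > 0" using d' d(1) zero_less_mult_pos[of p d'] \<open>p > 0\<close> by simp
    moreover have "d' < d" using d' \<open>d' > 0\<close> prime_gt_1_int[OF pp(1)] by simp
    ultimately have "\<not> K d'" by (rule min)
    then obtain c b where c: "vec c \<in> W" "b \<in> B" "\<not> n dvd d' * c b"
      using \<open>d' > 0\<close> unfolding K_def by blast
    have eq: "e * (c x div e) = c x" if "x \<in> B" for x using e_dvd[OF c(1) that] by simp
    have "vec (\<lambda>x. e * (c x div e)) = vec c" by (rule vec_cong) (simp add: eq)
    moreover have "\<not> p dvd c b div e"
    proof
      assume "p dvd c b div e"
      then have "d' * e * p dvd d' * e * (c b div e)" by (rule mult_dvd_mono[OF dvd_refl])
      then have "n dvd d' * c b" using eq[OF c(2)] by (simp add: n d' ac_simps)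
      with c(3) show False ..
    qed
    ultimately show "\<exists>c\<in>{c. vec (\<lambda>b. e * c b) \<in> W}. \<exists>b\<in>B. \<not> p dvd c b"
      using c by (intro bexI[of _ "\<lambda>x. c x div e"] bexI[of _ b]) simp_all
  qed (simp_all add: in_prime_factors_iff)
  then obtain c where c: "vec (\<lambda>b. e * c b) \<in> W" "\<forall>p\<in>prime_factors d. \<exists>b\<in>B. \<not> p dvd c b"
    by blast
  show thesis
  proof (rule that)
    show "\<forall>p. prime p \<longrightarrow> p dvd d \<longrightarrow> (\<exists>b\<in>B. \<not> p dvd c b)"
      using c(2) d(1) by (simp add: prime_factors_dvd)
  qed (use d \<open>d dvd n\<close> e_dvd c(1) in \<open>simp_all add: e_def\<close>)
qed

text \<open>Dividing the coordinates by \<open>n div d\<close> leaves at most \<open>d\<close>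
  values for each.\<close>

lemma card_le_exponent_power:
  assumes "d > 0" "d dvd n" "W \<subseteq> carrier V" "\<And>c b. vec c \<in> W \<Longrightarrow> b \<in> B \<Longrightarrow> n div d dvd c b"
  shows "card W \<le> nat d ^ card B"
proof -
  define e where "e = n div d"
  have n: "n = e * d" using \<open>d dvd n\<close> by (simp add: e_def)
  have "e > 0" using zero_less_mult_pos2[of e d] n n_gt_1 assms(1) by linarith
  have "W \<subseteq> (\<lambda>c. vec (\<lambda>b. e * c b)) ` (B \<rightarrow>\<^sub>E {0..<d})"
  proof
    fix v assume v: "v \<in> W"
    then have "v \<in> carrier V" using assms(3) by auto
    then obtain c where c: "c \<in> B \<rightarrow>\<^sub>E {0..<n}" "v = vec c" by (rule vec_surj)
    have eq: "e * (c b div e) = c b" if "b \<in> B" for b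
      using assms(4)[of c b] v that by (simp add: c e_def)
    have "c b div e \<in> {0..<d}" if b: "b \<in> B" for b
    proof -
      have "0 \<le> c b" "e * (c b div e) < e * d" using c(1) b eq[OF b] by (auto simp: n)
      then show ?thesis using \<open>e > 0\<close> by (simp add: pos_imp_zdiv_nonneg_iff)
    qed
    moreover have "vec (\<lambda>b. e * (\<lambda>b\<in>B. c b div e) b) = v"
      unfolding c(2) by (rule vec_cong) (simp add: eq)
    ultimately show "v \<in> (\<lambda>c. vec (\<lambda>b. e * c b)) ` (B \<rightarrow>\<^sub>E {0..<d})"
      by (intro image_eqI[of _ _ "\<lambda>b\<in>B. c b div e"]) auto
  qed
  then have "card W \<le> card ((\<lambda>c. vec (\<lambda>b. e * c b)) ` (B \<rightarrow>\<^sub>E {0..<d}))"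
    by (rule card_mono[rotated]) (intro finite_imageI finite_PiE finite_basis finite_atLeastLessThan_int)
  also have "\<dots> \<le> card (B \<rightarrow>\<^sub>E {0..<d})"
    by (rule card_image_le) (intro finite_PiE finite_basis finite_atLeastLessThan_int)
  finally show ?thesis using finite_basis by (simp add: card_PiE)
qed

text \<open>The vectors of order exactly \<open>d\<close>: these are \<open>n div d\<close> times a
  tuple modulo \<open>d\<close> whose entries have no common prime with \<open>d\<close>.\<close>

definition order_vectors :: "int \<Rightarrow> 'v set" where
  "order_vectors d = (\<lambda>c. vec (\<lambda>b. (n div d) * c b)) `
    {c \<in> B \<rightarrow>\<^sub>E {0..<d}. \<forall>p\<in>prime_factors d. \<exists>b\<in>B. \<not> p dvd c b}"

text \<open>The multiple by \<open>n div d\<close> modulo \<open>n\<close> determines the tuple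
  modulo \<open>d\<close>, so \<open>card_primitive_tuples\<close> applies.\<close>

lemma card_order_vectors:
  assumes "d > 0" "d dvd n"
  shows "real (card (order_vectors d))
    = (real_of_int d) ^ card B * (\<Prod>p\<in>prime_factors d. 1 - 1 / (real_of_int p) ^ card B)"
proof -
  define e where "e = n div d"
  have n: "n = e * d" using \<open>d dvd n\<close> by (simp add: e_def)
  have "e > 0" using zero_less_mult_pos2[of e d] n n_gt_1 assms(1) by linarith
  have "inj_on (\<lambda>c. vec (\<lambda>b. e * c b)) {c \<in> B \<rightarrow>\<^sub>E {0..<d}. \<forall>p\<in>prime_factors d. \<exists>b\<in>B. \<not> p dvd c b}"
  proof (rule inj_onI)
    fix c c' assume c: "c \<in> {c \<in> B \<rightarrow>\<^sub>E {0..<d}. \<forall>p\<in>prime_factors d. \<exists>b\<in>B. \<not> p dvd c b}"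
      "c' \<in> {c \<in> B \<rightarrow>\<^sub>E {0..<d}. \<forall>p\<in>prime_factors d. \<exists>b\<in>B. \<not> p dvd c b}"
      and eq: "vec (\<lambda>b. e * c b) = vec (\<lambda>b. e * c' b)"
    show "c = c'"
    proof (rule PiE_ext)
      show "c \<in> B \<rightarrow>\<^sub>E {0..<d}" "c' \<in> B \<rightarrow>\<^sub>E {0..<d}" using c by blast+
      fix b assume b: "b \<in> B"
      have "e * d dvd e * (c b - c' b)"
        using eq b by (simp add: vec_eq_iff cong_iff_dvd_diff right_diff_distrib flip: n)
      then have "d dvd c b - c' b" using \<open>e > 0\<close> by simp
      then have "c b mod d = c' b mod d" by (simp add: mod_eq_dvd_iff)
      moreover have "c b \<in> {0..<d}" "c' b \<in> {0..<d}" using c b by (auto simp only: PiE_iff mem_Collect_eq)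
      ultimately show "c b = c' b" by simp
    qed
  qed
  then have "card (order_vectors d)
      = card {c \<in> B \<rightarrow>\<^sub>E {0..<d}. \<forall>p\<in>prime_factors d. \<exists>b\<in>B. \<not> p dvd c b}"
    unfolding order_vectors_def e_def[symmetric] by (rule card_image)
  then show ?thesis
    using card_primitive_tuples[of "prime_factors d" B d] finite_basis assms(1)
    by (simp add: in_prime_factors_iff)
qed

section \<open>Many restrictions for the full group, few for a group acting abelianly\<close>

text \<open>The maps \<open>a s \<otimes> (h f \<otimes> g0)\<close> are told apart on
  \<open>U\<close>: \<open>g0\<close> moves the given vector \<open>w\<close> of order
  \<open>d\<close> to the normal form \<open>\<delta>\<close>, the transvection \<open>h f\<close>
  fixes \<open>\<delta>\<close>, and \<open>a s\<close> moves \<open>\<delta>\<close> to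
  \<open>s\<close>. So the value at \<open>w\<close> reveals \<open>s\<close>, and the other values
  then reveal the functional \<open>f\<close> on the image of \<open>U\<close> under
  \<open>g0\<close>. Duality supplies at least \<open>card U / d\<close> such functionals.\<close>

lemma card_mult_le_card_restrictions:
  assumes d: "d > 0" "d dvd n" and "B \<noteq> {}"
    and U: "U \<subseteq> carrier V" "\<And>u v. u \<in> U \<Longrightarrow> v \<in> U \<Longrightarrow> u \<oplus> v \<in> U"
    and exponent: "\<And>c b. vec c \<in> U \<Longrightarrow> b \<in> B \<Longrightarrow> n div d dvd c b"
    and w: "vec (\<lambda>b. (n div d) * c1 b) \<in> U" "\<And>p. prime p \<Longrightarrow> p dvd d \<Longrightarrow> \<exists>b\<in>B. \<not> p dvd c1 b"
  shows "card (order_vectors d) * card U \<le> nat d * card ((\<lambda>h. restrict h U) ` carrier G)"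
proof -
  obtain i where i: "i \<in> B" using \<open>B \<noteq> {}\<close> by blast
  define e where "e = n div d"
  define w where "w = vec (\<lambda>b. e * c1 b)"
  define \<delta> where "\<delta> = vec (\<lambda>b. if b = i then e else 0)"
  define D where "D = B - {i}"
  define F where "F = D \<rightarrow>\<^sub>E {0..<n}"
  have n: "n = e * d" using \<open>d dvd n\<close> by (simp add: e_def)
  have "e > 0" using zero_less_mult_pos2[of e d] n n_gt_1 d(1) by linarith
  have wU: "w \<in> U" using w(1) by (simp add: w_def e_def)
  have finU: "finite U" using U(1) finite_carrier by (rule finite_subset)
  obtain g0 where g0: "g0 \<in> carrier G" "g0 w = \<delta>"
    using order_d_vectors_transitive[OF i d w(2)] unfolding w_def \<delta>_def e_def by blast
  have "\<exists>a\<in>carrier G. a \<delta> = s" if s: "s \<in> order_vectors d" for s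
  proof -
    obtain c where c: "\<forall>p\<in>prime_factors d. \<exists>b\<in>B. \<not> p dvd c b" "s = vec (\<lambda>b. e * c b)"
      using s unfolding order_vectors_def e_def by blast
    have "\<exists>b\<in>B. \<not> p dvd c b" if "prime p" "p dvd d" for p
      using c(1) that d(1) by (simp add: prime_factors_dvd)
    from order_d_vectors_transitive[OF i d this]
    obtain g where g: "g \<in> carrier G" "g s = \<delta>" unfolding c(2) \<delta>_def e_def by blast
    have "(inv\<^bsub>G\<^esub> g) \<delta> = s" using G_inv[OF g(1), of s] g(2) by (simp add: c(2))
    then show ?thesis using G.inv_closed[OF g(1)] by blast
  qed
  then obtain a where a: "\<And>s. s \<in> order_vectors d \<Longrightarrow> a s \<in> carrier G"
      "\<And>s. s \<in> order_vectors d \<Longrightarrow> a s \<delta> = s"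
    using bchoice[of "order_vectors d" "\<lambda>s g. g \<in> carrier G \<and> g \<delta> = s"] by blast
  define h where "h f = (SOME g. g \<in> carrier G \<and> (\<forall>c. g (vec c) = vec (row_map i 1 f c)))" for f
  have h': "h f \<in> carrier G \<and> (\<forall>c. h f (vec c) = vec (row_map i 1 f c))" for f
  proof -
    obtain g where "g \<in> carrier G" "\<forall>c. g (vec c) = vec (row_map i 1 f c)"
      using exists_row_automorphism[OF i, of 1 f] by auto
    then show ?thesis
      unfolding h_def by (intro someI[of "\<lambda>g. g \<in> carrier G \<and> (\<forall>c. g (vec c) = vec (row_map i 1 f c))"] conjI)
  qed
  then have h: "h f \<in> carrier G" "h f (vec c) = vec (row_map i 1 f c)" for f c by simp_all
  \<comment> \<open>A transvection in row \<open>i\<close> fixes every vector whose coordinates off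
    \<open>i\<close> vanish.\<close>
  have h_\<delta>: "h f \<delta> = \<delta>" for f
    unfolding \<delta>_def h(2) by (rule vec_cong) (simp add: row_map_def)
  define coord where "coord v = (SOME c. vec c = v)" for v
  have coord: "vec (coord v) = v" if vV: "v \<in> carrier V" for v
  proof -
    obtain c where "v = vec c" using vec_surj[OF vV] by blast
    then show ?thesis unfolding coord_def by (intro someI_ex[of "\<lambda>c. vec c = v"] exI[of _ c]) simp
  qed
  define x where "x u = coord (g0 u)" for u
  have x: "vec (x u) = g0 u" if "u \<in> U" for u
    unfolding x_def by (rule coord[OF G_closed[OF g0(1) subsetD[OF U(1) that]]])
  have x_add: "[x (u \<oplus> v) b = x u b + x v b] (mod n)" if "u \<in> U" "v \<in> U" "b \<in> B" for u v b
  proof -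
    have "vec (x (u \<oplus> v)) = vec (\<lambda>b. x u b + x v b)"
      using G_add[OF g0(1) subsetD[OF U(1) that(1)] subsetD[OF U(1) that(2)]]
      by (simp add: x that U(2) flip: vec_add)
    then show ?thesis using that(3) by (simp add: vec_eq_iff)
  qed
  let ?\<rho> = "\<lambda>f. \<lambda>u\<in>U. (\<Sum>j\<in>D. f j * x u j) mod n"
  let ?Z = "{u \<in> U. \<forall>j\<in>D. n dvd x u j}"
  have card_U: "card U \<le> card (?\<rho> ` F) * card ?Z"
    unfolding F_def
  proof (rule card_le_card_functionals[where s = "\<lambda>u v. u \<oplus> v"])
    show "finite D" using finite_basis by (simp add: D_def)
    \<comment> \<open>\<open>U\<close> is assumed closed under addition; its finiteness makes the
      injective translations bijective.\<close>
    show "bij_betw ((\<oplus>) u) U U" if u: "u \<in> U" for u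
    proof -
      have "inj_on ((\<oplus>) u) U"
        using u U(1) by (intro inj_onI) (simp add: subset_iff)
      moreover have "(\<oplus>) u ` U \<subseteq> U" using U(2) u by blast
      ultimately show ?thesis using finU by (simp add: bij_betw_def endo_inj_surj)
    qed
    show "[x (u \<oplus> v) j = x u j + x v j] (mod n)" if "u \<in> U" "v \<in> U" "j \<in> D" for u v j
      using x_add that by (simp add: D_def)
  qed (use n_gt_1 finU in simp_all)
  have e_dvd: "e dvd x u b" if u: "u \<in> U" and b: "b \<in> B" for u b
  proof -
    have "u \<in> carrier V" using u U(1) by blast
    then obtain c where c: "u = vec c" using vec_surj by blast
    \<comment> \<open>\<open>d\<close> annihilates \<open>u\<close> and so also \<open>g0 u\<close>,
      which makes the coordinates of the latter multiples of \<open>e\<close>.\<close>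
    have "vec (\<lambda>b. d * c b) = vec (\<lambda>b. 0 * c b)"
    proof (rule vec_cong)
      fix b assume "b \<in> B"
      then have "e dvd c b" using exponent[of c b] u by (simp add: c e_def)
      then have "n dvd d * c b" unfolding n mult.commute[of e] by (intro mult_dvd_mono dvd_refl)
      then show "[d * c b = 0 * c b] (mod n)" by (simp add: cong_0_iff)
    qed
    moreover have "g0 (vec (\<lambda>b. k * c b)) = vec (\<lambda>b. k * x u b)" for k
      using x[OF u] c by (intro G_scale g0(1)) simp
    ultimately have "vec (\<lambda>b. d * x u b) = vec (\<lambda>b. 0 * x u b)" by metis
    then have "n dvd d * x u b" using b by (simp add: vec_eq_iff cong_0_iff)
    then show ?thesis using d(1) by (subst (asm) n) (simp add: mult.commute[of e])
  qed
  \<comment> \<open>On \<open>?Z\<close> only coordinate \<open>i\<close> of \<open>g0 u\<close> is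
    left. It is a multiple of \<open>e\<close> modulo \<open>n = e * d\<close>, so it takes at most
    \<open>d\<close> values.\<close>
  have "card ?Z \<le> card {0..<d}"
  proof (rule card_inj_on_le)
    show "inj_on (\<lambda>u. (x u i div e) mod d) ?Z"
    proof (rule inj_onI)
      fix u v assume u: "u \<in> ?Z" and v: "v \<in> ?Z" and eq: "(x u i div e) mod d = (x v i div e) mod d"
      have uv: "u \<in> U" "v \<in> U" using u v by blast+
      have "e * d dvd e * (x u i div e - x v i div e)" using eq by (simp add: mod_eq_dvd_iff)
      then have "n dvd x u i - x v i"
        using e_dvd[OF uv(1) i] e_dvd[OF uv(2) i] by (simp add: right_diff_distrib flip: n)
      moreover have "n dvd x u b - x v b" if "b \<in> D" for b
        using u v that by (intro dvd_diff) blast+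
      ultimately have "vec (x u) = vec (x v)"
        unfolding D_def by (intro vec_cong) (auto simp only: cong_iff_dvd_diff Diff_iff)
      then have "g0 u = g0 v" using uv by (simp add: x)
      then show "u = v" using uv U(1) G_inj[OF g0(1)] by blast
    qed
    show "(\<lambda>u. (x u i div e) mod d) ` ?Z \<subseteq> {0..<d}" using d(1) by (intro image_subsetI) simp
  qed simp
  then have card_Z: "card ?Z \<le> nat d" by simp
  \<comment> \<open>One functional is chosen for each restriction to \<open>U\<close>, since
    different functionals may restrict to the same map.\<close>
  define form where "form = inv_into F ?\<rho>"
  have form: "?\<rho> (form \<phi>) = \<phi>" if "\<phi> \<in> ?\<rho> ` F" for \<phi>
    unfolding form_def using that by (rule f_inv_into_f)
  let ?m = "\<lambda>(s, \<phi>). restrict (a s \<otimes>\<^bsub>G\<^esub> (h (form \<phi>) \<otimes>\<^bsub>G\<^esub> g0)) U"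
  have m: "?m (s, \<phi>) v = a s (h (form \<phi>) (g0 v))" if s: "s \<in> order_vectors d" and v: "v \<in> U" for s \<phi> v
  proof -
    have "v \<in> carrier V" using v U(1) by blast
    then show ?thesis using v h(1) g0(1) a(1)[OF s] G_closed[OF g0(1)] by (simp add: G_mult)
  qed
  have "inj_on ?m (order_vectors d \<times> ?\<rho> ` F)"
  proof (rule inj_onI)
    fix p q assume pq: "p \<in> order_vectors d \<times> ?\<rho> ` F" "q \<in> order_vectors d \<times> ?\<rho> ` F"
      and eq: "?m p = ?m q"
    from pq(1) obtain s \<phi> where p: "p = (s, \<phi>)" "s \<in> order_vectors d" "\<phi> \<in> ?\<rho> ` F"
      by (rule SigmaE)
    from pq(2) obtain t \<psi> where q: "q = (t, \<psi>)" "t \<in> order_vectors d" "\<psi> \<in> ?\<rho> ` F"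
      by (rule SigmaE)
    note s = p(2) and t = q(2) and \<phi> = p(3) and \<psi> = q(3)
    have eq': "a s (h (form \<phi>) (g0 v)) = a t (h (form \<psi>) (g0 v))" if v: "v \<in> U" for v
      using m[OF s v, of \<phi>] m[OF t v, of \<psi>] fun_cong[OF eq, of v] unfolding p(1) q(1) by argo
    \<comment> \<open>Evaluation at \<open>w\<close>, which \<open>g0\<close> sends to the common
      fixed vector \<open>\<delta>\<close> of the transvections.\<close>
    have st: "s = t" using eq'[OF wU] a(2)[OF s] a(2)[OF t] by (simp add: g0(2) h_\<delta>)
    have "?\<rho> (form \<phi>) v = ?\<rho> (form \<psi>) v" for v
    proof (cases "v \<in> U")
      case True
      then have g0v: "g0 v \<in> carrier V" using U(1) G_closed[OF g0(1)] by blast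
      have "h (form \<phi>) (g0 v) = h (form \<psi>) (g0 v)"
        using eq'[OF True] unfolding st by (rule G_inj[OF a(1)[OF t] G_closed[OF h(1) g0v] G_closed[OF h(1) g0v]])
      then have "vec (row_map i 1 (form \<phi>) (x v)) = vec (row_map i 1 (form \<psi>) (x v))"
        by (simp only: h(2)[symmetric] x[OF True])
      then have "[row_map i 1 (form \<phi>) (x v) i = row_map i 1 (form \<psi>) (x v) i] (mod n)"
        using i by (simp only: vec_eq_iff)
      then have "[(\<Sum>j\<in>D. form \<phi> j * x v j) = (\<Sum>j\<in>D. form \<psi> j * x v j)] (mod n)"
        by (simp add: row_map_def D_def cong_add_lcancel)
      then show ?thesis using True by (simp add: cong_def)
    qed simp
    then have "?\<rho> (form \<phi>) = ?\<rho> (form \<psi>)" by (rule ext)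
    then show "p = q" using st form[OF \<phi>] form[OF \<psi>] unfolding p(1) q(1) by (simp only:)
  qed
  moreover have "?m ` (order_vectors d \<times> ?\<rho> ` F) \<subseteq> (\<lambda>h. restrict h U) ` carrier G"
  proof (rule image_subsetI)
    fix p assume "p \<in> order_vectors d \<times> ?\<rho> ` F"
    then obtain s \<phi> where p: "p = (s, \<phi>)" "s \<in> order_vectors d" by (rule SigmaE)
    show "?m p \<in> (\<lambda>h. restrict h U) ` carrier G"
      unfolding p(1) prod.case by (intro imageI G.m_closed a(1)[OF p(2)] h(1) g0(1))
  qed
  ultimately have "card (order_vectors d \<times> ?\<rho> ` F) \<le> card ((\<lambda>h. restrict h U) ` carrier G)"
    by (rule card_inj_on_le) (intro finite_imageI finite_G)
  then have Res: "card (order_vectors d) * card (?\<rho> ` F) \<le> card ((\<lambda>h. restrict h U) ` carrier G)"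
    by (simp only: card_cartesian_product)
  have "card (order_vectors d) * card U \<le> card (order_vectors d) * (card (?\<rho> ` F) * nat d)"
    by (intro mult_le_mono2 order_trans[OF card_U] card_Z)
  also have "\<dots> = card (order_vectors d) * card (?\<rho> ` F) * nat d" by (simp only: mult.assoc)
  also have "\<dots> \<le> card ((\<lambda>h. restrict h U) ` carrier G) * nat d" by (rule mult_le_mono1[OF Res])
  finally show ?thesis by (simp only: mult.commute)
qed

lemma restricted_group_commute:
  assumes \<Gamma>: "\<Gamma> \<subseteq> carrier G" and W: "W \<subseteq> carrier V" and inv: "invariant_under \<Gamma> W"
    and comm: "comm_group (restricted_group (residue_ring n) V \<Gamma> W)"
    and g: "g \<in> \<Gamma>" and h: "h \<in> \<Gamma>" and v: "v \<in> W"
  shows "g (h v) = h (g v)"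
proof -
  have W_inv: "k x \<in> W" if "k \<in> \<Gamma>" "x \<in> W" for k x
    using inv that by (auto simp: invariant_under_def)
  \<comment> \<open>The product of \<open>BijGroup\<close> is composition only for members of
    \<open>Bij W\<close>. As \<open>W\<close> is finite, injectivity and invariance place the
    restrictions there.\<close>
  have Bij: "restrict k W \<in> Bij W" if k: "k \<in> \<Gamma>" for k
  proof -
    have "inj_on k W"
      using G_inj[of k] subsetD[OF \<Gamma> k] W by (intro inj_onI) (simp add: subset_iff)
    moreover have "k ` W \<subseteq> W" using W_inv[OF k] by (rule image_subsetI)
    ultimately have "bij_betw k W W"
      using finite_subset[OF W finite_carrier] by (simp add: bij_betw_def endo_inj_surj)
    then show ?thesis by (simp add: Bij_def bij_betw_restrict_eq)
  qed
  have mult: "(restrict k W \<otimes>\<^bsub>restricted_group (residue_ring n) V \<Gamma> W\<^esub> restrict l W) v = k (l v)"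
    if "k \<in> \<Gamma>" "l \<in> \<Gamma>" for k l
    using that Bij W_inv v by (simp add: restricted_group_def module_Aut_def BijGroup_def compose_def)
  have "restrict g W \<otimes>\<^bsub>restricted_group (residue_ring n) V \<Gamma> W\<^esub> restrict h W
      = restrict h W \<otimes>\<^bsub>restricted_group (residue_ring n) V \<Gamma> W\<^esub> restrict g W"
    by (rule comm_monoid.m_comm[OF comm_group.axioms(1)[OF comm]])
      (use g h in \<open>auto simp: restricted_group_def\<close>)
  then show ?thesis using mult[OF g h] mult[OF h g] by simp
qed

text \<open>An element of \<open>\<Gamma>\<close> is determined on \<open>U\<close> by its value at
  \<open>w\<close>, and these values lie in \<open>U\<close>, so \<open>\<Gamma>\<close> has at most
  \<open>card U\<close> restrictions to \<open>U\<close>. Combined with the lower bound for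
  \<open>G\<close> and \<open>card_restrictions_le_index\<close>, this lets the factor
  \<open>card U\<close> cancel.\<close>

lemma card_order_vectors_le_index:
  assumes "B \<noteq> {}" and \<Gamma>: "subgroup \<Gamma> G" and W: "submodule W (residue_ring n) V"
    and inv: "invariant_under \<Gamma> W"
    and comm: "comm_group (restricted_group (residue_ring n) V \<Gamma> W)"
  obtains d where "d > 0" "d dvd n" "card W \<le> nat d ^ card B"
    "card (order_vectors d) \<le> nat d * subgroup_index G \<Gamma>"
proof -
  interpret W: submodule W "residue_ring n" V by (rule W)
  have W_sub: "W \<subseteq> carrier V" using W.subset by simp
  have \<Gamma>G: "\<Gamma> \<subseteq> carrier G" using \<Gamma> by (rule subgroup.subset)
  obtain d c where d: "d > 0" "d dvd n"
    and exponent': "\<forall>c. vec c \<in> W \<longrightarrow> (\<forall>b\<in>B. n div d dvd c b)"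
    and c: "vec (\<lambda>b. (n div d) * c b) \<in> W" "\<forall>p. prime p \<longrightarrow> p dvd d \<longrightarrow> (\<exists>b\<in>B. \<not> p dvd c b)"
    by (rule exists_exponent_vector[OF W])
  have exponent: "n div d dvd c b" if "vec c \<in> W" "b \<in> B" for c b using exponent' that by blast
  define w where "w = vec (\<lambda>b. (n div d) * c b)"
  define U where "U = {v \<in> W. \<forall>g\<in>\<Gamma>. \<forall>h\<in>\<Gamma>. g w = h w \<longrightarrow> g v = h v}"
  have wU: "w \<in> U" using c(1) by (simp add: U_def w_def)
  have U_W: "U \<subseteq> W" by (simp add: U_def)
  have U_sub: "U \<subseteq> carrier V" using U_W W_sub by (rule order_trans)
  have finU: "finite U" using U_sub finite_carrier by (rule finite_subset)
  have fin\<Gamma>: "finite \<Gamma>" using \<Gamma>G finite_G by (rule finite_subset)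
  have U_add: "u \<oplus> v \<in> U" if "u \<in> U" "v \<in> U" for u v
  proof -
    have "g (u \<oplus> v) = h (u \<oplus> v)" if gh: "g \<in> \<Gamma>" "h \<in> \<Gamma>" "g w = h w" for g h
    proof -
      have "g u = h u" "g v = h v" using \<open>u \<in> U\<close> \<open>v \<in> U\<close> gh by (simp_all add: U_def)
      then show ?thesis
        using G_add[OF subsetD[OF \<Gamma>G gh(1)] subsetD[OF U_sub \<open>u \<in> U\<close>] subsetD[OF U_sub \<open>v \<in> U\<close>]]
          G_add[OF subsetD[OF \<Gamma>G gh(2)] subsetD[OF U_sub \<open>u \<in> U\<close>] subsetD[OF U_sub \<open>v \<in> U\<close>]]
        by simp
    qed
    moreover have "u \<oplus> v \<in> W" using W.m_closed[of u v] that U_W by auto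
    ultimately show ?thesis by (simp add: U_def)
  qed
  have orbit: "g w \<in> U" if g: "g \<in> \<Gamma>" for g
  proof -
    \<comment> \<open>Commutativity on \<open>W\<close> gives
      \<open>h (g w) = g (h w) = g (k w) = k (g w)\<close>.\<close>
    have "h (g w) = k (g w)" if "h \<in> \<Gamma>" "k \<in> \<Gamma>" "h w = k w" for h k
      using restricted_group_commute[OF \<Gamma>G W_sub inv comm that(1) g, of w]
        restricted_group_commute[OF \<Gamma>G W_sub inv comm that(2) g, of w] that(3) c(1)
      by (simp add: w_def)
    moreover have "g w \<in> W" using inv g c(1) by (auto simp: invariant_under_def w_def)
    ultimately show ?thesis by (simp add: U_def)
  qed
  let ?Res = "\<lambda>H. (\<lambda>h. restrict h U) ` H"
  define pick where "pick y = (SOME g. g \<in> \<Gamma> \<and> g w = y)" for y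
  have "?Res \<Gamma> \<subseteq> (\<lambda>y. restrict (pick y) U) ` (\<lambda>g. g w) ` \<Gamma>"
  proof (rule image_subsetI)
    fix g assume g: "g \<in> \<Gamma>"
    have p: "pick (g w) \<in> \<Gamma> \<and> pick (g w) w = g w"
      unfolding pick_def by (rule someI[of "\<lambda>h. h \<in> \<Gamma> \<and> h w = g w" g]) (simp add: g)
    have "restrict g U = restrict (pick (g w)) U"
      by (rule restrict_ext) (use p g in \<open>simp add: U_def\<close>)
    then show "restrict g U \<in> (\<lambda>y. restrict (pick y) U) ` (\<lambda>g. g w) ` \<Gamma>" using g by simp
  qed
  then have "card (?Res \<Gamma>) \<le> card ((\<lambda>y. restrict (pick y) U) ` (\<lambda>g. g w) ` \<Gamma>)"
    by (rule card_mono[rotated]) (intro finite_imageI fin\<Gamma>)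
  also have "\<dots> \<le> card ((\<lambda>g. g w) ` \<Gamma>)" by (rule card_image_le) (intro finite_imageI fin\<Gamma>)
  also have "\<dots> \<le> card U" by (rule card_mono[OF finU]) (rule image_subsetI, rule orbit)
  finally have Res_\<Gamma>: "card (?Res \<Gamma>) \<le> card U" .
  have "card (order_vectors d) * card U \<le> nat d * card (?Res (carrier G))"
    by (rule card_mult_le_card_restrictions[OF d \<open>B \<noteq> {}\<close> U_sub U_add _ wU[unfolded w_def]])
      (use exponent U_W c(2) in blast)+
  also have "\<dots> \<le> nat d * (subgroup_index G \<Gamma> * card U)"
    by (intro mult_le_mono2 order_trans[OF card_restrictions_le_index[OF \<Gamma> U_sub]] Res_\<Gamma>)
  finally have "card (order_vectors d) * card U \<le> nat d * subgroup_index G \<Gamma> * card U"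
    by (simp only: mult.assoc)
  moreover have "card U > 0" using wU finU by (auto simp: card_gt_0_iff)
  ultimately have "card (order_vectors d) \<le> nat d * subgroup_index G \<Gamma>" by simp
  moreover have "card W \<le> nat d ^ card B"
    using exponent by (intro card_le_exponent_power d W_sub)
  ultimately show thesis using that d by blast
qed

end

section \<open>From the count of vectors of order \<open>d\<close> to the bound on the
  submodule\<close>

theorem proposition1p1:
  fixes n :: int and m :: nat
    and V :: "(int, 'v, 'z) module_scheme"
    and \<Gamma> :: "('v \<Rightarrow> 'v) set" and W :: "'v set"
  assumes "n > 1" and "m > 1"
    and "free_module_of_rank (residue_ring n) V m"
    and "subgroup \<Gamma> (module_Aut (residue_ring n) V)"
    and "submodule W (residue_ring n) V"
    and "invariant_under \<Gamma> W"
    and "comm_group (restricted_group (residue_ring n) V \<Gamma> W)"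
  shows "real (card W) \<le>
    real (subgroup_index (module_Aut (residue_ring n) V) \<Gamma>) powr (1 + real m / 2)
      * zeta 2 powr ((real m - 1) * (1 + real m / 2))"
proof -
  obtain B where B: "module (residue_ring n) V" "module_basis (residue_ring n) V B" "card B = m"
    using assms(3) unfolding free_module_of_rank_def by blast
  interpret free_residue_module n V B
    by (intro free_residue_module.intro free_residue_module_axioms.intro B assms(1))
  have "B \<noteq> {}" using B(3) assms(2) by auto
  from card_order_vectors_le_index[OF this assms(4-7)] obtain d where d: "d > 0" "d dvd n"
    and card_W: "card W \<le> nat d ^ card B"
    and index: "card (order_vectors d) \<le> nat d * subgroup_index G \<Gamma>" by blast
  define I where "I = real (subgroup_index G \<Gamma>)"
  define \<delta> where "\<delta> = real_of_int d"
  have \<delta>: "\<delta> \<ge> 1" "real (nat d) = \<delta>" using d(1) by (simp_all add: \<delta>_def)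
  have z: "zeta 2 \<ge> 1" using zeta_2_mult_euler_product_ge_1[of "{}"] by simp
  \<comment> \<open>Since \<open>m\<close> is at least 2, the finite Euler product with exponent 2
    bounds the one with exponent \<open>m\<close> from below, which makes \<open>zeta 2\<close>
    serve for every \<open>m\<close>.\<close>
  have "(\<Prod>p\<in>prime_factors d. 1 - 1 / (real_of_int p)^2)
      \<le> (\<Prod>p\<in>prime_factors d. 1 - 1 / (real_of_int p) ^ m)"
  proof (rule prod_mono)
    fix p assume "p \<in> prime_factors d"
    then have "prime p" by auto
    then have p: "real_of_int p \<ge> 1" using prime_gt_0_int[of p] by linarith
    have "(real_of_int p)^2 \<le> (real_of_int p) ^ m"
      using assms(2) by (intro power_increasing p) simp
    then show "0 \<le> 1 - 1 / (real_of_int p)^2 \<and> 1 - 1 / (real_of_int p)^2 \<le> 1 - 1 / (real_of_int p) ^ m"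
      using p by (simp add: frac_le)
  qed
  then have "zeta 2 * (\<Prod>p\<in>prime_factors d. 1 - 1 / (real_of_int p)^2)
      \<le> zeta 2 * (\<Prod>p\<in>prime_factors d. 1 - 1 / (real_of_int p) ^ m)"
    using z by (intro mult_left_mono) simp_all
  moreover have "1 \<le> zeta 2 * (\<Prod>p\<in>prime_factors d. 1 - 1 / (real_of_int p)^2)"
    by (rule zeta_2_mult_euler_product_ge_1) auto
  ultimately have "1 \<le> zeta 2 * (\<Prod>p\<in>prime_factors d. 1 - 1 / (real_of_int p) ^ m)" by linarith
  then have "\<delta> ^ m * 1 \<le> \<delta> ^ m * (zeta 2 * (\<Prod>p\<in>prime_factors d. 1 - 1 / (real_of_int p) ^ m))"
    using \<delta>(1) by (intro mult_left_mono) simp_all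
  also have "\<dots> = zeta 2 * real (card (order_vectors d))"
    by (simp add: card_order_vectors[OF d] B(3) \<delta>_def)
  also have "\<dots> \<le> zeta 2 * (\<delta> * I)"
    using z of_nat_mono[OF index, where 'a = real] by (intro mult_left_mono) (simp_all add: I_def \<delta>(2))
  finally have "\<delta> * \<delta> ^ (m - 1) \<le> \<delta> * (zeta 2 * I)"
    using assms(2) by (simp add: power_eq_if ac_simps)
  then have le: "\<delta> ^ (m - 1) \<le> zeta 2 * I" using \<delta>(1) by simp
  have "1 \<le> \<delta> ^ (m - 1)" using \<delta>(1) by (rule one_le_power)
  \<comment> \<open>This permits enlarging the exponent of \<open>zeta 2 * I\<close> below.\<close>
  then have zI: "1 \<le> zeta 2 * I" using le by linarith
  have m: "real m \<ge> 2" using assms(2) by simp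
  \<comment> \<open>After clearing denominators, the inequality between the exponents is
    \<open>(m - 2) * (m + 1) \<ge> 0\<close>.\<close>
  have "0 \<le> (real m - 2) * (real m + 1)" using m by simp
  then have ratio: "real m / (real m - 1) \<le> 1 + real m / 2"
    using m by (simp add: divide_le_eq algebra_simps)
  have "real (card W) \<le> \<delta> ^ m"
    using of_nat_mono[OF card_W, where 'a = real] by (simp add: \<delta>(2) B(3))
  also have "\<dots> = (\<delta> ^ (m - 1)) powr (real m / (real m - 1))"
    using \<delta>(1) m assms(2) by (simp add: powr_powr of_nat_diff flip: powr_realpow)
  also have "\<dots> \<le> (zeta 2 * I) powr (real m / (real m - 1))"
    using le \<delta>(1) m by (intro powr_mono2) simp_all
  also have "\<dots> \<le> (zeta 2 * I) powr (1 + real m / 2)" by (rule powr_mono[OF ratio zI])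
  also have "\<dots> = I powr (1 + real m / 2) * zeta 2 powr (1 + real m / 2)"
    using z by (simp add: powr_mult I_def)
  \<comment> \<open>The exponent of \<open>zeta 2\<close> may be multiplied by \<open>m - 1\<close>,
    which is at least 1, because \<open>zeta 2\<close> is at least 1.\<close>
  also have "\<dots> \<le> I powr (1 + real m / 2) * zeta 2 powr ((real m - 1) * (1 + real m / 2))"
    using z m by (intro mult_left_mono powr_mono) simp_all
  finally show ?thesis by (simp add: I_def)
qed

end
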